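(* Let $n\ge 1$ and $k$ be integers, let $N$ be an odd positive integer, let $\chi$ be a Dirichlet character modulo $N$, and let $T\in\Lambda_n^+$ be fundamental with $\gcd(\mathrm{disc}(T),N)=1$. Let $\varphi\in J^{\mathrm{cusp}}_{k,T}(\Gamma_0(N),\chi)$ be a nonzero cuspidal Jacobi form with theta decomposition $\varphi=\sum_{\mu\in\mathbb{Z}^n/2T\mathbb{Z}^n}h_\mu\Theta_{\mu,T}$. Then there exists $\mu\in\mathbb{Z}^n/2T\mathbb{Z}^n$ such that $h_\mu\neq 0$ and the rational number $T^{-1}[\mu/2]$ has maximum possible denominator, equal to $\mathrm{lvl}(T)$.
   Context: Half-integral matrices: $\Lambda_n^+$ is the set of symmetric positive definite $n\times n$ matrices $T$ with integer diagonal entries and off-diagonal entries in $\frac12\mathbb{Z}$. The discriminant is $\mathrm{disc}(T)=d_T:=\det(2T)$ if $n$ is even and $\frac12\det(2T)$ if $n$ is odd; $T$ is fundamental if $d_T$ is odd and square-free. The level $\mathrm{lvl}(T)$ is the least positive integer $\ell$ such that $\ell(2T)^{-1}$ is even (integral with even diagonal). For fundamental $T$, $\mathrm{lvl}(T)=d_T$ for $n$ even and $4d_T$ for $n$ odd. For a symmetric matrix $S$ and a column vector $x$, $S[x]:={}^txSx$. The denominator of $T^{-1}[\mu/2]$ (in lowest terms) depends only on the class of $\mu$ modulo $2T\mathbb{Z}^n$, and "maximum possible" refers to varying $\mu$. Jacobi forms (elements of $\mathbb{C}^n$ and $\mathbb{Z}^n$ are written as columns): $\mathbb{H}$ is the upper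 half-plane. For $\phi:\mathbb{H}\times\mathbb{C}^n\to\mathbb{C}$ and $g=\begin{pmatrix}a&b\\c&d\end{pmatrix}\in\mathrm{SL}_2(\mathbb{Z})$ put $$(\phi|_{k,T}g)(\tau,z)=\phi\Big(\tfrac{a\tau+b}{c\tau+d},\tfrac{z}{c\tau+d}\Big)(c\tau+d)^{-k}e^{-2\pi i\,cT[z]/(c\tau+d)}.$$ A (scalar-valued) Jacobi form of weight $k$, index $T$, nebentypus $\chi$ for $\Gamma_0(N)$ is a holomorphic $\phi:\mathbb{H}\times\mathbb{C}^n\to\mathbb{C}$ such that: (1) $\phi|_{k,T}g=\chi(d)\phi$ for all $g=\begin{pmatrix}a&b\\c&d\end{pmatrix}\in\Gamma_0(N)$; (2) $\phi(\tau,z+x\tau+y)=e^{-2\pi i(T[x]\tau+2\,{}^txTz)}\phi(\tau,z)$ for all $x,y\in\mathbb{Z}^n$; (3) for every $g\in\mathrm{SL}_2(\mathbb{Z})$, $\phi|_{k,T}g$ has a Fourier expansion $\sum_{m\ge0}\sum_{r\in\mathbb{Z}^n}c_g(m,r)e^{2\pi i m\tau}e^{2\pi i\,{}^trz}$ (with $m\in\frac1N\mathbb{Z}$), in which $c_g(m,r)\ne0$ implies $\begin{pmatrix}m&{}^tr/2\\ r/2&T\end{pmatrix}\ge0$. It is cuspidal if for every $g$, $c_g(m,r)\neq0$ implies that this matrix is positive definite. $J^{\mathrm{cusp}}_{k,T}(\Gamma_0(N),\chi)$ is the space of cuspidal ones. Theta decomposition: by (2), $\phi$ is uniquely of the form $\phi(\tau,z)=\sum_{\mu\in\mathbb{Z}^n/2T\mathbb{Z}^n}h_\mu(\tau)\Theta_{\mu,T}(\tau,z)$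 with $h_\mu$ holomorphic on $\mathbb{H}$ (the theta components), where, with $\tilde\mu=(2T)^{-1}\mu$, $$\Theta_{\mu,T}(\tau,z)=\sum_{\ell\in\mathbb{Z}^n}e^{2\pi i\left(T[\ell+\tilde\mu]\tau+2\,{}^t(\ell+\tilde\mu)Tz\right)}.$$ *)

theory Defs
  imports "HOL-Complex_Analysis.Complex_Analysis"
    "HOL-Computational_Algebra.Computational_Algebra"
begin

section \<open>Half-integral matrices\<close>

definition bform :: "real^'n^'n \<Rightarrow> 'a::real_algebra_1^'n \<Rightarrow> 'a^'n \<Rightarrow> 'a" where
  "bform S x y = (\<Sum>i\<in>UNIV. \<Sum>j\<in>UNIV. x$i * of_real (S$i$j) * y$j)"

text \<open>\<open>qform S x\<close> is \<open>S[x]\<close>; it is used with real and with complex vectors.\<close>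

definition qform :: "real^'n^'n \<Rightarrow> 'a::real_algebra_1^'n \<Rightarrow> 'a" where
  "qform S x = bform S x x"

definition int_vec :: "int^'n \<Rightarrow> 'a::ring_1^'n" where
  "int_vec m = (\<chi> i. of_int (m$i))"

definition pos_semidef :: "real^'n^'n \<Rightarrow> bool" where
  "pos_semidef S \<longleftrightarrow> transpose S = S \<and> (\<forall>x. qform S x \<ge> (0::real))"

definition pos_def :: "real^'n^'n \<Rightarrow> bool" where
  "pos_def S \<longleftrightarrow> transpose S = S \<and> (\<forall>x. x \<noteq> 0 \<longrightarrow> qform S x > (0::real))"

text \<open>The set \<open>\<Lambda>\<^sub>n\<^sup>+\<close> for \<open>n = CARD('n)\<close>.\<close>

definition half_integral_pos :: "(real^'n^'n) set" where
  "half_integral_pos =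
     {T. pos_def T \<and> (\<forall>i. T$i$i \<in> \<int>) \<and> (\<forall>i j. 2 * T$i$j \<in> \<int>)}"

text \<open>For \<open>T\<close> in \<^const>\<open>half_integral_pos\<close> the argument of the floor is an integer
  (if \<open>n\<close> is odd, the determinant of the even matrix \<open>2T\<close> is even).\<close>

definition disc :: "real^'n^'n \<Rightarrow> int" where
  "disc T = \<lfloor>if even CARD('n) then det (2 *\<^sub>R T) else det (2 *\<^sub>R T) / 2\<rfloor>"

definition fundamental :: "real^'n^'n \<Rightarrow> bool" where
  "fundamental T \<longleftrightarrow> odd (disc T) \<and> squarefree (disc T)"

definition even_matrix :: "real^'n^'n \<Rightarrow> bool" where
  "even_matrix S \<longleftrightarrow> (\<forall>i j. S$i$j \<in> \<int>) \<and> (\<forall>i. S$i$i / 2 \<in> \<int>)"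

definition lvl :: "real^'n^'n \<Rightarrow> nat" where
  "lvl T = (LEAST l. l > 0 \<and> even_matrix (real l *\<^sub>R matrix_inv (2 *\<^sub>R T)))"

text \<open>The denominator, in lowest terms, of a real number that is rational.\<close>

definition denominator :: "real \<Rightarrow> int" where
  "denominator x = snd (quotient_of (the_inv (of_rat :: rat \<Rightarrow> real) x))"

text \<open>\<open>coset_rel T\<close> is congruence modulo \<open>2T\<int>\<^sup>n\<close> on \<open>\<int>\<^sup>n\<close>.\<close>

definition coset_rel :: "real^'n^'n \<Rightarrow> ((int^'n) \<times> (int^'n)) set" where
  "coset_rel T = {(\<mu>, \<nu>). \<exists>x. (int_vec \<nu> :: real^'n) = int_vec \<mu> + (2 *\<^sub>R T) *v int_vec x}"

definition coset :: "real^'n^'n \<Rightarrow> int^'n \<Rightarrow> (int^'n) set" where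
  "coset T \<mu> = coset_rel T `` {\<mu>}"

definition cosets :: "real^'n^'n \<Rightarrow> (int^'n) set set" where
  "cosets T = UNIV // coset_rel T"


section \<open>Jacobi forms\<close>

definition upper_half_plane :: "complex set" where
  "upper_half_plane = {\<tau>. Im \<tau> > 0}"

definition SL2Z :: "(int^2^2) set" where
  "SL2Z = {g. det g = 1}"

definition Gamma0 :: "nat \<Rightarrow> (int^2^2) set" where
  "Gamma0 N = {g \<in> SL2Z. int N dvd g$2$1}"

definition dirichlet_character :: "nat \<Rightarrow> (int \<Rightarrow> complex) \<Rightarrow> bool" where
  "dirichlet_character N \<psi> \<longleftrightarrow>
     (\<forall>a b. \<psi> (a * b) = \<psi> a * \<psi> b) \<and>
     (\<forall>a. \<psi> (a + int N) = \<psi> a) \<and>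
     (\<forall>a. \<psi> a \<noteq> 0 \<longleftrightarrow> coprime a (int N))"

text \<open>Holomorphy in several variables: Frechet differentiability with a
  \<open>\<complex>\<close>-linear derivative.\<close>

definition jointly_holomorphic :: "(complex \<Rightarrow> complex^'n \<Rightarrow> complex) \<Rightarrow> bool" where
  "jointly_holomorphic \<phi> \<longleftrightarrow>
     (\<forall>p \<in> upper_half_plane \<times> UNIV. \<exists>D.
        ((\<lambda>(\<tau>, z). \<phi> \<tau> z) has_derivative D) (at p) \<and>
        (\<forall>c u v. D (c * u, c *s v) = c * D (u, v)))"

definition slash ::
  "int \<Rightarrow> real^'n^'n \<Rightarrow> int^2^2 \<Rightarrow> (complex \<Rightarrow> complex^'n \<Rightarrow> complex)
     \<Rightarrow> complex \<Rightarrow> complex^'n \<Rightarrow> complex" where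
  "slash k T g \<phi> \<tau> z =
     (let a = of_int (g$1$1); b = of_int (g$1$2); c = of_int (g$2$1); d = of_int (g$2$2);
          J = c * \<tau> + d
      in \<phi> ((a * \<tau> + b) / J) ((1 / J) *s z) * J powi (- k)
           * exp (- (2 * of_real pi * \<i> * c * qform T z / J)))"

text \<open>The symmetric block matrix with blocks \<open>m\<close>, \<open>r/2\<close> and \<open>T\<close>; the index \<open>None\<close> is the
  additional first coordinate.\<close>

definition jacobi_matrix :: "real \<Rightarrow> int^'n \<Rightarrow> real^'n^'n \<Rightarrow> real^('n option)^('n option)" where
  "jacobi_matrix m r T =
     (\<chi> i j. case (i, j) of
         (None, None) \<Rightarrow> m
       | (None, Some b) \<Rightarrow> of_int (r$b) / 2
       | (Some a, None) \<Rightarrow> of_int (r$a) / 2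
       | (Some a, Some b) \<Rightarrow> T$a$b)"

text \<open>The exponents \<open>m \<ge> 0\<close> in \<open>(1/N)\<int>\<close> are written as \<open>j/N\<close> with a natural number \<open>j\<close>,
  so \<open>c j r\<close> is the coefficient at \<open>(j/N, r)\<close>.\<close>

definition has_fourier_expansion ::
  "nat \<Rightarrow> (complex \<Rightarrow> complex^'n \<Rightarrow> complex) \<Rightarrow> (nat \<Rightarrow> int^'n \<Rightarrow> complex) \<Rightarrow> bool" where
  "has_fourier_expansion N f c \<longleftrightarrow>
     (\<forall>\<tau>\<in>upper_half_plane. \<forall>z.
        ((\<lambda>(j, r). c j r * exp (2 * of_real pi * \<i> * of_real (real j / real N) * \<tau>)
                         * exp (2 * of_real pi * \<i> * (\<Sum>i\<in>UNIV. of_int (r$i) * z$i)))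
           has_sum f \<tau> z) UNIV)"

definition jacobi_form ::
  "int \<Rightarrow> real^'n^'n \<Rightarrow> nat \<Rightarrow> (int \<Rightarrow> complex) \<Rightarrow> (complex \<Rightarrow> complex^'n \<Rightarrow> complex) \<Rightarrow> bool" where
  "jacobi_form k T N \<psi> \<phi> \<longleftrightarrow>
     jointly_holomorphic \<phi> \<and>
     (\<forall>g\<in>Gamma0 N. \<forall>\<tau>\<in>upper_half_plane. \<forall>z.
        slash k T g \<phi> \<tau> z = \<psi> (g$2$2) * \<phi> \<tau> z) \<and>
     (\<forall>\<tau>\<in>upper_half_plane. \<forall>z. \<forall>x y :: int^'n.
        \<phi> \<tau> (z + \<tau> *s int_vec x + int_vec y) =
          exp (- (2 * of_real pi * \<i> * (qform T (int_vec x) * \<tau> + 2 * bform T (int_vec x) z)))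
            * \<phi> \<tau> z) \<and>
     (\<forall>g\<in>SL2Z. \<exists>c. has_fourier_expansion N (slash k T g \<phi>) c \<and>
        (\<forall>j r. c j r \<noteq> 0 \<longrightarrow> pos_semidef (jacobi_matrix (real j / real N) r T)))"

definition jacobi_cusp_forms ::
  "int \<Rightarrow> real^'n^'n \<Rightarrow> nat \<Rightarrow> (int \<Rightarrow> complex) \<Rightarrow> (complex \<Rightarrow> complex^'n \<Rightarrow> complex) set" where
  "jacobi_cusp_forms k T N \<psi> =
     {\<phi>. jacobi_form k T N \<psi> \<phi> \<and>
        (\<forall>g\<in>SL2Z. \<forall>c. has_fourier_expansion N (slash k T g \<phi>) c \<longrightarrow>
           (\<forall>j r. c j r \<noteq> 0 \<longrightarrow> pos_def (jacobi_matrix (real j / real N) r T)))}"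


section \<open>Theta decomposition\<close>

definition jacobi_theta :: "real^'n^'n \<Rightarrow> int^'n \<Rightarrow> complex \<Rightarrow> complex^'n \<Rightarrow> complex" where
  "jacobi_theta T \<mu> \<tau> z =
     (let \<mu>' = matrix_inv (2 *\<^sub>R T) *v int_vec \<mu>;
          v = (\<lambda>l::int^'n. \<chi> i. complex_of_real ((int_vec l + \<mu>') $ i))
      in \<Sum>\<^sub>\<infinity>l\<in>UNIV. exp (2 * of_real pi * \<i> * (qform T (v l) * \<tau> + 2 * bform T (v l) z)))"

text \<open>The theta components are indexed by the cosets \<open>C\<close>; the theta function does not depend on
  the representative of \<open>C\<close>.\<close>

definition theta_decomposition ::
  "real^'n^'n \<Rightarrow> (complex \<Rightarrow> complex^'n \<Rightarrow> complex) \<Rightarrow> ((int^'n) set \<Rightarrow> complex \<Rightarrow> complex) \<Rightarrow> bool" where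
  "theta_decomposition T \<phi> h \<longleftrightarrow>
     (\<forall>C\<in>cosets T. h C holomorphic_on upper_half_plane) \<and>
     (\<forall>\<tau>\<in>upper_half_plane. \<forall>z.
        \<phi> \<tau> z = (\<Sum>C\<in>cosets T. h C \<tau> * jacobi_theta T (SOME \<mu>. \<mu> \<in> C) \<tau> z))"

end

theory Submission imports Defs begin

text \<open>
  Write \<open>F\<^sub>\<mu> = h\<^sub>\<mu> \<Theta>\<^sub>\<mu>\<close> and \<open>W = (2T)\<^sup>-\<^sup>1\<close>.  The translations \<open>z \<mapsto> z + W a\<close>, \<open>a \<in> \<int>\<^sup>n\<close>, act on
  \<open>F\<^sub>\<mu>\<close> by a character that determines \<open>\<mu>\<close> modulo \<open>2T\<int>\<^sup>n\<close>.  Since \<open>\<delta> = |det (2T)|\<close> is squarefree,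
  the form on each \<open>p\<close>-part of \<open>\<int>\<^sup>n/2T\<int>\<^sup>n\<close> is anisotropic, so \<open>T\<^sup>-\<^sup>1[\<mu>/2]\<close> has full denominator as
  soon as \<open>\<mu>\<close> has nonzero \<open>p\<close>-component for all \<open>p\<close> dividing \<open>\<delta>\<close>.

  Choose \<open>\<mu>\<close> with \<open>F\<^sub>\<mu> \<noteq> 0\<close> and the fewest vanishing \<open>p\<close>-components, and suppose that the component
  at \<open>p\<close> vanishes.  For a suitable multiple \<open>c\<close> of \<open>N \<delta>/p\<close> prime to \<open>p\<close>, the matrix \<open>(1, 0; c, 1)\<close> fixes
  \<open>\<phi>\<close> and commutes with the translations by \<open>W p a\<close>; hence it fixes the sum of the \<open>F\<^sub>\<nu>\<close> over all \<open>\<nu>\<close>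
  that differ from \<open>\<mu>\<close> only at \<open>p\<close>, and by minimality this sum is \<open>F\<^sub>\<mu>\<close>.  But the matrix carries the
  translation by \<open>v = (\<delta>/p) W b\<close>, which fixes \<open>F\<^sub>\<mu>\<close>, to the Heisenberg translation by
  \<open>c v \<tau> + v\<close>, which changes the character of \<open>F\<^sub>\<mu>\<close> for some \<open>b\<close>: a contradiction.  No theta
  inversion or convergence is needed: the operators act term by term on the theta series.
\<close>

section \<open>Integral symmetric matrices\<close>

text \<open>Two-element orbits contribute \<open>2 * f x\<close>, so only fixed points matter modulo
  2.\<close>

lemma even_sum_involution:
  fixes f :: "'a \<Rightarrow> int"
  assumes "finite P"
    and "\<And>x. x \<in> P \<Longrightarrow> g x \<in> P \<and> g (g x) = x \<and> f (g x) = f x \<and> (g x = x \<longrightarrow> even (f x))"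
  shows "even (\<Sum>x\<in>P. f x)"
  using assms
proof (induction P rule: finite_psubset_induct)
  case (psubset P)
  show ?case
  proof (cases "P = {}")
    case False
    then obtain x where x: "x \<in> P" by blast
    have "P - {x, g x} \<subset> P" using x by blast
    moreover have "\<And>y. y \<in> P - {x, g x} \<Longrightarrow> g y \<in> P - {x, g x}"
      using psubset.prems x by (metis DiffD1 DiffD2 DiffI insertCI insertE singletonD)
    ultimately have ev: "even (\<Sum>y\<in>P - {x, g x}. f y)"
      using psubset.prems psubset.IH by (metis (no_types, lifting) DiffD1)
    have "(\<Sum>y\<in>P. f y) = (\<Sum>y\<in>P - {x, g x}. f y) + (\<Sum>y\<in>{x, g x}. f y)"
      by (rule sum.subset_diff) (use psubset x in auto)
    moreover have "even (\<Sum>y\<in>{x, g x}. f y)"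
      using psubset.prems[OF x] by (cases "g x = x") auto
    ultimately show ?thesis using ev by simp
  qed simp
qed

text \<open>In the Leibniz formula a permutation and its inverse give equal terms. A self-inverse
  permutation of an odd number of points has a fixed point, so its term contains an even diagonal
  entry.\<close>

lemma even_det_even_symmetric:
  fixes A :: "int^'n^'n"
  assumes sym: "\<And>i j. A$i$j = A$j$i" and diag: "\<And>i. even (A$i$i)"
    and odd: "odd CARD('n)"
  shows "even (det A)"
  unfolding det_def
proof (rule even_sum_involution[where g = inv])
  show "finite {p. p permutes (UNIV :: 'n set)}" by simp
next
  fix p :: "'n \<Rightarrow> 'n" assume "p \<in> {p. p permutes UNIV}"
  then have p: "p permutes UNIV" by simp
  have "(\<Prod>i\<in>UNIV. A$i$inv p i) = (\<Prod>i\<in>UNIV. A$p i$i)"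
    by (rule prod.reindex_bij_witness[of _ p "inv p"])
      (use permutes_inverses[OF p] in auto)
  also have "\<dots> = (\<Prod>i\<in>UNIV. A$i$p i)" by (simp add: sym)
  finally have prod: "(\<Prod>i\<in>UNIV. A$i$inv p i) = (\<Prod>i\<in>UNIV. A$i$p i)" .
  have fix_even: "even (of_int (sign p) * (\<Prod>i\<in>UNIV. A$i$p i))" if "inv p = p"
  proof -
    have "\<exists>i. p i = i"
    proof (rule ccontr)
      assume "\<nexists>i. p i = i"
      then have "even (\<Sum>i\<in>(UNIV :: 'n set). (1::int))"
        using that permutes_inverses(1)[OF p] by (intro even_sum_involution[where g = p]) auto
      with odd show False by simp
    qed
    then obtain i where i: "p i = i" by blast
    have "A$i$p i dvd (\<Prod>i\<in>UNIV. A$i$p i)" by (rule dvd_prodI) auto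
    then show ?thesis using diag[of i] i by auto
  qed
  have "permutation p" using p unfolding permutation_permutes by (meson finite)
  then have sign: "sign (inv p) = sign p" by (rule sign_inverse)
  show "inv p \<in> {p. p permutes UNIV} \<and> inv (inv p) = p \<and>
    of_int (sign (inv p)) * (\<Prod>i\<in>UNIV. A$i$inv p i) = of_int (sign p) * (\<Prod>i\<in>UNIV. A$i$p i) \<and>
    (inv p = p \<longrightarrow> even (of_int (sign p) * (\<Prod>i\<in>UNIV. A$i$p i)))"
    using permutes_inv[OF p] inv_inv_eq[OF permutes_bij[OF p]] prod fix_even sign
    by auto
qed

section \<open>Integral vectors inside the real vector space\<close>

definition integral_vec :: "real^'n \<Rightarrow> bool" where
  "integral_vec v \<longleftrightarrow> (\<forall>i. v$i \<in> \<int>)"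

lemma integral_int_vec [simp]: "integral_vec (int_vec m)"
  by (simp add: integral_vec_def int_vec_def)

lemma integral_vecE:
  assumes "integral_vec v" obtains m where "v = int_vec m"
proof
  show "v = int_vec (\<chi> i. \<lfloor>v$i\<rfloor>)"
    using assms by (simp add: integral_vec_def int_vec_def vec_eq_iff)
qed

lemma integral_vec_add: "integral_vec u \<Longrightarrow> integral_vec v \<Longrightarrow> integral_vec (u + v)"
  and integral_vec_diff: "integral_vec u \<Longrightarrow> integral_vec v \<Longrightarrow> integral_vec (u - v)"
  and integral_vec_scale: "c \<in> \<int> \<Longrightarrow> integral_vec v \<Longrightarrow> integral_vec (c *\<^sub>R v)"
  and integral_vec_inner: "integral_vec u \<Longrightarrow> integral_vec v \<Longrightarrow> u \<bullet> v \<in> \<int>"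
  and integral_vec_axis: "integral_vec (axis i 1)"
  by (auto simp: integral_vec_def inner_vec_def axis_def)

lemma integral_vec_dual:
  assumes "\<And>m :: int^'n. v \<bullet> int_vec m \<in> \<int>"
  shows "integral_vec v"
  unfolding integral_vec_def
proof
  fix i
  have "int_vec (axis i 1) = (axis i 1 :: real^'n)"
    by (simp add: int_vec_def axis_def vec_eq_iff)
  with assms[of "axis i 1"] show "v$i \<in> \<int>" by (simp add: inner_axis)
qed

lemma det_of_int: "det (\<chi> i j. real_of_int (A$i$j)) = of_int (det A)"
  by (simp add: det_def)

lemma integral_matE:
  fixes A :: "real^'n^'n"
  assumes "\<And>i j. A$i$j \<in> \<int>"
  obtains B :: "int^'n^'n" where "A = (\<chi> i j. real_of_int (B$i$j))"
proof
  show "A = (\<chi> i j. real_of_int ((\<chi> i j. \<lfloor>A$i$j\<rfloor>)$i$j))"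
    using assms by (simp add: vec_eq_iff)
qed

lemma det_in_Ints:
  fixes A :: "real^'n^'n"
  assumes "\<And>i j. A$i$j \<in> \<int>"
  shows "det A \<in> \<int>"
  using integral_matE[OF assms] by (metis Ints_of_int det_of_int)

text \<open>The terms at \<open>(i, j)\<close> and \<open>(j, i)\<close> agree and the diagonal
  entries are even, so the double sum is even.\<close>

lemma even_matrix_qform:
  fixes E :: "real^'n^'n"
  assumes E: "even_matrix E" and sym: "transpose E = E" and u: "integral_vec u"
  shows "u \<bullet> (E *v u) / 2 \<in> \<int>"
proof -
  obtain B where B: "E = (\<chi> i j. real_of_int (B$i$j))"
    using E integral_matE[of E] by (auto simp: even_matrix_def)
  obtain m where m: "u = int_vec m" using integral_vecE[OF u] by blast
  have symB: "B$i$j = B$j$i" for i j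
    using sym unfolding B by (simp add: transpose_def vec_eq_iff)
  have diag: "even (B$i$i)" for i
  proof -
    have "real_of_int (B$i$i) / 2 \<in> \<int>" using E by (simp add: even_matrix_def B)
    then obtain k where "real_of_int (B$i$i) / 2 = of_int k" by (elim Ints_cases)
    then have "B$i$i = 2 * k" by linarith
    then show ?thesis by simp
  qed
  have "even (\<Sum>(i,j)\<in>UNIV \<times> UNIV. m$i * (B$i$j * m$j))"
  proof (rule even_sum_involution[where g = prod.swap])
    fix x :: "'n \<times> 'n"
    obtain i j where x: "x = (i, j)" by fastforce
    have "m$j * (B$j$i * m$i) = m$i * (B$i$j * m$j)" using symB[of i j] by simp
    then show "prod.swap x \<in> UNIV \<times> UNIV \<and> prod.swap (prod.swap x) = x \<and>
        (case prod.swap x of (i, j) \<Rightarrow> m$i * (B$i$j * m$j)) = (case x of (i, j) \<Rightarrow> m$i * (B$i$j * m$j)) \<and>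
        (prod.swap x = x \<longrightarrow> even (case x of (i, j) \<Rightarrow> m$i * (B$i$j * m$j)))"
      using diag[of i] by (cases "i = j") (simp_all add: x)
  qed simp
  then obtain k where "(\<Sum>(i,j)\<in>UNIV \<times> UNIV. m$i * (B$i$j * m$j)) = 2 * k" by (rule evenE)
  then have k: "(\<Sum>i\<in>UNIV. \<Sum>j\<in>UNIV. m$i * (B$i$j * m$j)) = 2 * k"
    by (simp add: sum.cartesian_product)
  have "u \<bullet> (E *v u) = of_int (\<Sum>i\<in>UNIV. \<Sum>j\<in>UNIV. m$i * (B$i$j * m$j))"
    by (simp add: m B inner_vec_def matrix_vector_mult_def int_vec_def sum_distrib_left)
  then show ?thesis unfolding k by simp
qed

text \<open>If \<open>p\<close> did not divide \<open>y\<close>, then \<open>y\<close> could be completed to a basis over \<open>\<int>\<^sub>(\<^sub>p\<^sub>)\<close> in which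
  a row and a column of \<open>S\<close> are divisible by \<open>p\<close>; Cramer's rule replaces the change of basis.\<close>

lemma anisotropic_mod_prime:
  fixes S :: "real^'n^'n" and p :: int
  assumes S: "\<And>i j. S$i$j \<in> \<int>" and sym: "transpose S = S"
    and x: "integral_vec x" and y: "integral_vec y"
    and Sy: "S *v y = of_int p *\<^sub>R x" and yx: "y \<bullet> x = of_int p * of_int k"
    and p: "prime p" and det: "det S = of_int \<delta>" "\<not> p^2 dvd \<delta>"
  shows "integral_vec ((1 / of_int p) *\<^sub>R y)"
proof -
  have p0: "p \<noteq> 0" using p by auto
  have symS: "S$a$b = S$b$a" for a b
  proof -
    have "S$a$b = (transpose S)$a$b" by (simp only: sym)
    then show ?thesis by (simp only: transpose_def vec_lambda_beta)
  qed
  have "real_of_int \<lfloor>y$i\<rfloor> / of_int p \<in> \<int>" for i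
  proof -
    obtain m where m: "y = int_vec m" using integral_vecE[OF y] by blast
    \<comment> \<open>\<open>S1\<close> replaces column \<open>i\<close> of \<open>S\<close> by
      \<open>x\<close>, and \<open>S2\<close> then replaces row \<open>i\<close> by
      \<open>w\<close>, where \<open>p w\<close> is the combination of the rows of \<open>S1\<close>
      with coefficients \<open>y\<close>. By Cramer's rule each replacement trades a factor
      \<open>y$i\<close> for a factor \<open>p\<close>.\<close>
    define S1 where "S1 = (\<chi> a b. if b = i then x$a else S$a$b)"
    define w where "w = (\<chi> b. if b = i then of_int k else x$b)"
    define S2 where "S2 = (\<chi> a. if a = i then w else S1$a)"
    have w: "integral_vec w" using x by (auto simp: w_def integral_vec_def)
    have iS1: "S1$a$b \<in> \<int>" for a b using x S by (auto simp: S1_def integral_vec_def)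
    have iS2: "S2$a$b \<in> \<int>" for a b using iS1 w by (auto simp: S2_def integral_vec_def)
    have t1: "transpose (\<chi> a b. if b = i then (S *v y)$a else S$a$b) =
        (\<chi> b. if b = i then of_int p *s x else S$b)"
      by (subst vec_eq_iff, subst vec_eq_iff) (simp add: transpose_def Sy symS)
    have t2: "transpose S1 = (\<chi> b. if b = i then x else S$b)"
      by (subst vec_eq_iff, subst vec_eq_iff) (simp add: transpose_def S1_def symS)
    have "y$i * det S = det (\<chi> b. if b = i then of_int p *s x else S$b)"
      by (simp only: t1[symmetric] det_transpose cramer_lemma)
    also have "\<dots> = of_int p * det S1"
      by (simp only: det_row_mul t2[symmetric] det_transpose)
    finally have d1: "y$i * det S = of_int p * det S1" .
    have row: "(\<Sum>a\<in>UNIV. y$a *s row a S1) = of_int p *s w"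
    proof (subst vec_eq_iff, intro allI)
      fix b
      have *: "(\<Sum>a\<in>UNIV. y$a * x$a) = of_int p * of_int k" using yx by (simp add: inner_vec_def)
      have "(\<Sum>a\<in>UNIV. y$a * S$a$b) = (\<Sum>a\<in>UNIV. S$b$a * y$a)"
        by (rule sum.cong) (simp_all add: symS[of _ b])
      also have "\<dots> = (S *v y)$b" by (simp add: matrix_vector_mult_def)
      finally have "(\<Sum>a\<in>UNIV. y$a * S$a$b) = of_int p * x$b" by (simp add: Sy)
      with * show "(\<Sum>a\<in>UNIV. y$a *s row a S1)$b = (of_int p *s w)$b"
        by (simp add: row_def S1_def w_def)
    qed
    have "y$i * det S1 = det (\<chi> a. if a = i then of_int p *s w else S1$a)"
      using cramer_lemma_transpose[of i y S1] unfolding row by (simp add: row_def cong: if_cong)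
    also have "\<dots> = of_int p * det S2" by (subst det_row_mul) (simp add: S2_def)
    finally have d2: "y$i * det S1 = of_int p * det S2" .
    obtain l where l: "det S2 = of_int l" using det_in_Ints[of S2] iS2 by (metis Ints_cases)
    have "(y$i)^2 * det S = of_int p * (y$i * det S1)" using d1 by (simp add: power2_eq_square)
    also have "\<dots> = (of_int p)^2 * of_int l" using d2 l by (simp add: power2_eq_square)
    finally have "real_of_int ((m$i)^2 * \<delta>) = of_int (p^2 * l)"
      by (simp add: m int_vec_def det)
    then have eq: "(m$i)^2 * \<delta> = p^2 * l" by linarith
    have "p dvd m$i"
    proof (rule ccontr)
      assume "\<not> p dvd m$i"
      then have "coprime (p^2) ((m$i)^2)" using p by (simp add: prime_imp_coprime)
      moreover have "p^2 dvd (m$i)^2 * \<delta>" using eq by simp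
      ultimately show False using det(2) by (simp add: coprime_dvd_mult_right_iff)
    qed
    then show ?thesis using p0 by (auto simp: m int_vec_def)
  qed
  then show ?thesis using y by (simp add: integral_vec_def)
qed

section \<open>Denominators\<close>

lemma denominator_of_rat: "denominator (of_rat r) = snd (quotient_of r)"
proof -
  have "the_inv (of_rat :: rat \<Rightarrow> real) (of_rat r) = r"
    by (rule the_inv_f_f) (simp add: inj_def)
  then show ?thesis by (simp add: denominator_def)
qed

lemma denominator_dvd_iff:
  assumes "x \<in> \<rat>"
  shows "of_int l * x \<in> \<int> \<longleftrightarrow> denominator x dvd l"
proof -
  obtain r where r: "x = of_rat r" using assms by (elim Rats_cases)
  obtain a b where ab: "quotient_of r = (a, b)" by fastforce
  have b: "b > 0" and cop: "coprime a b"
    using quotient_of_denom_pos[OF ab] quotient_of_coprime[OF ab] by auto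
  have x: "x = of_int a / of_int b"
    using quotient_of_div[OF ab] by (simp add: r of_rat_divide)
  have "of_int l * x \<in> \<int> \<longleftrightarrow> b dvd l * a"
  proof
    assume "of_int l * x \<in> \<int>"
    then obtain k where "of_int l * x = of_int k" by (elim Ints_cases)
    then have "real_of_int (l * a) = of_int (b * k)" using b by (simp add: x field_simps)
    then show "b dvd l * a" by (metis dvd_triv_left of_int_eq_iff)
  next
    assume "b dvd l * a"
    then obtain k where "l * a = b * k" by (elim dvdE)
    then have "real_of_int l * of_int a = of_int b * of_int k" by (metis of_int_mult)
    then have "of_int l * x = of_int k" using b by (simp add: x field_simps)
    then show "of_int l * x \<in> \<int>" by simp
  qed
  also have "\<dots> \<longleftrightarrow> b dvd l"
    using cop by (simp add: coprime_commute coprime_dvd_mult_left_iff)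
  finally show ?thesis by (simp add: r denominator_of_rat ab)
qed

lemma in_Rats_if_mult_in_Ints:
  assumes "of_int l * x \<in> \<int>" "l \<noteq> 0"
  shows "(x::real) \<in> \<rat>"
proof -
  obtain k where "of_int l * x = of_int k" using assms(1) by (elim Ints_cases)
  then have "x = of_int k / of_int l" using assms(2) by (simp add: field_simps)
  then show ?thesis by simp
qed

lemma denominator_pos: "x \<in> \<rat> \<Longrightarrow> denominator x > 0"
  by (metis Rats_cases denominator_of_rat quotient_of_denom_pos')

text \<open>If the denominator d were a proper divisor of \<open>l\<close>, a prime p dividing l/d
  would make d divide \<open>l div p\<close>; so testing the maximal proper divisors of
  \<open>l\<close> suffices.\<close>

lemma denominator_eqI:
  assumes "x \<in> \<rat>" "l > 0" "of_int l * x \<in> \<int>"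
    and "\<And>p. prime p \<Longrightarrow> p dvd l \<Longrightarrow> of_int (l div p) * x \<notin> \<int>"
  shows "denominator x = l"
proof (rule ccontr)
  let ?d = "denominator x"
  assume ne: "?d \<noteq> l"
  have "?d dvd l" using assms(1,3) by (simp add: denominator_dvd_iff)
  then obtain m where m: "l = ?d * m" by (elim dvdE)
  have d: "?d > 0" using assms(1) by (rule denominator_pos)
  then have "m > 0" using m assms(2) by (metis zero_less_mult_pos)
  then have "\<not> is_unit m" using ne m by (simp add: zdvd1_eq)
  then obtain p where p: "prime p" "p dvd m"
    using \<open>m > 0\<close> prime_divisor_exists[of m] by auto
  then obtain m' where m': "m = p * m'" by (elim dvdE)
  have "l div p = ?d * m'" using p(1) m m' by (simp add: mult.left_commute)
  then have "of_int (l div p) * x \<in> \<int>"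
    using assms(1) by (simp add: denominator_dvd_iff del: of_int_mult)
  moreover have "p dvd l" using m m' by simp
  ultimately show False using assms(4) p(1) by blast
qed

section \<open>The discriminant group of a fundamental matrix\<close>

lemma qform_eq_inner: "qform A u = u \<bullet> (A *v u)"
  by (simp add: qform_def bform_def inner_vec_def matrix_vector_mult_def sum_distrib_left mult.assoc)

locale fundamental_index =
  fixes T :: "real^'n^'n"
  assumes half_integral: "T \<in> half_integral_pos" and fundamental: "fundamental T"
begin

definition S where "S = 2 *\<^sub>R T"

definition W where "W = matrix_inv S"

text \<open>The order of \<int>^n/2T\<int>^n; the absolute value allows working with the determinant
  up to sign.\<close>

definition \<delta> :: int where "\<delta> = \<bar>\<lfloor>det S\<rfloor>\<bar>"

lemma T_sym: "transpose T = T"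
  using half_integral by (simp add: half_integral_pos_def pos_def_def)

lemma S_sym: "transpose S = S"
  by (simp only: S_def transpose_scalar T_sym)

lemma even_matrix_S: "even_matrix S"
  using half_integral by (simp add: half_integral_pos_def even_matrix_def S_def)

lemma S_Ints: "S$i$j \<in> \<int>"
  using even_matrix_S by (simp add: even_matrix_def)

lemma det_S: "det S = of_int \<lfloor>det S\<rfloor>"
  using det_in_Ints[OF S_Ints] by simp

lemma even_det_S_if_odd: "even \<lfloor>det S\<rfloor>" if "odd CARD('n)"
proof -
  obtain B :: "int^'n^'n" where B: "S = (\<chi> i j. real_of_int (B$i$j))"
    using integral_matE[OF S_Ints] by blast
  have "transpose S$i$j = S$j$i" for i j by (simp only: transpose_def vec_lambda_beta)
  then have "S$i$j = S$j$i" for i j by (simp only: S_sym)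
  then have sym: "B$i$j = B$j$i" for i j by (simp add: B)
  have diag: "even (B$i$i)" for i
  proof -
    have "real_of_int (B$i$i) / 2 \<in> \<int>" using even_matrix_S by (simp add: even_matrix_def B)
    then obtain k where "real_of_int (B$i$i) / 2 = of_int k" by (elim Ints_cases)
    then have "B$i$i = 2 * k" by linarith
    then show ?thesis by simp
  qed
  show ?thesis using even_det_even_symmetric[OF sym diag that] by (simp add: B det_of_int)
qed

lemma disc_T:
  shows "even CARD('n) \<Longrightarrow> \<lfloor>det S\<rfloor> = disc T"
    and "odd CARD('n) \<Longrightarrow> \<lfloor>det S\<rfloor> = 2 * disc T"
proof -
  assume "odd CARD('n)"
  moreover from this obtain k where "\<lfloor>det S\<rfloor> = 2 * k"
    using even_det_S_if_odd by (meson evenE)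
  ultimately show "\<lfloor>det S\<rfloor> = 2 * disc T"
    using det_S by (simp add: disc_def S_def)
qed (simp add: disc_def S_def)

text \<open>For odd n the determinant is twice the odd number \<open>disc T\<close>, so the extra
  factor 2 keeps it squarefree.\<close>

lemma squarefree_\<delta>: "squarefree \<delta>"
proof -
  have "squarefree \<lfloor>det S\<rfloor>"
  proof (cases "even CARD('n)")
    case False
    moreover have "squarefree (2 * disc T)"
      using fundamental
      by (intro squarefree_mult_coprime squarefree_prime[of "2 :: int"]) (auto simp: fundamental_def)
    ultimately show ?thesis by (simp add: disc_T)
  qed (use fundamental disc_T in \<open>simp add: fundamental_def\<close>)
  then show ?thesis by (cases "\<lfloor>det S\<rfloor> \<ge> 0") (simp_all add: \<delta>_def)
qed

lemma \<delta>_pos: "\<delta> > 0"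
  using squarefree_\<delta> by (cases "\<delta> = 0") (auto simp: \<delta>_def)

lemma odd_\<delta>: "even CARD('n) \<Longrightarrow> odd \<delta>"
  using fundamental by (simp add: \<delta>_def disc_T fundamental_def)

lemma even_\<delta>: "odd CARD('n) \<Longrightarrow> even \<delta>"
  by (simp add: \<delta>_def disc_T)

text \<open>Oddness of \<open>N\<close> enters here: for odd n the prime 2 divides \<delta> but not
  the discriminant.\<close>

lemma coprime_\<delta>:
  assumes "coprime (disc T) (int N)" "odd N"
  shows "coprime \<delta> (int N)"
  using assms by (cases "even CARD('n)") (auto simp: \<delta>_def disc_T)

lemma det_S_cases: "det S = of_int \<delta> \<or> det S = - of_int \<delta>"
  using det_S by (auto simp: \<delta>_def abs_if)

lemma S_W: "S ** W = mat 1" and W_S: "W ** S = mat 1"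
proof -
  have "invertible S" using det_S_cases \<delta>_pos by (auto simp: invertible_det_nz)
  then have "S ** W = mat 1 \<and> W ** S = mat 1"
    unfolding invertible_def W_def matrix_inv_def by (rule someI_ex)
  then show "S ** W = mat 1" "W ** S = mat 1" by simp_all
qed

lemma S_W_vec [simp]: "S *v (W *v v) = v"
  by (simp add: matrix_vector_mul_assoc S_W)

lemma W_sym: "transpose W = W"
  by (metis S_W S_sym W_S matrix_mul_assoc matrix_mul_lid matrix_mul_rid matrix_transpose_mul transpose_mat)

text \<open>Cramer's rule expresses \<open>det S *\<^sub>R (W *v v)\<close> by determinants of
  integral matrices.\<close>

lemma \<delta>_W_integral:
  assumes "integral_vec v"
  shows "integral_vec (of_int \<delta> *\<^sub>R (W *v v))"
proof -
  have nz: "det S \<noteq> 0" using det_S_cases \<delta>_pos by auto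
  have "W *v v = (\<chi> k. det (\<chi> i j. if j = k then v$i else S$i$j) / det S)"
    using cramer[OF nz, of "W *v v" v] by simp
  then have "integral_vec (det S *\<^sub>R (W *v v))"
    using nz assms S_Ints by (auto simp: integral_vec_def intro!: det_in_Ints)
  then show ?thesis using det_S_cases by (auto simp: integral_vec_def)
qed

text \<open>\<open>anisotropic_mod_prime\<close> applies to \<open>x = e u\<close> and
  \<open>y = \<delta> W u\<close>, for which \<open>S y = p x\<close>. The conclusion says that the
  p-component of the class of \<open>u\<close> in \<int>^n/2T\<int>^n vanishes.\<close>

lemma anisotropic:
  assumes p: "prime p" and e: "\<delta> = p * e" and u: "integral_vec u"
    and q: "of_int e * (u \<bullet> (W *v u)) \<in> \<int>"
  shows "integral_vec (of_int e *\<^sub>R (W *v u))"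
proof -
  obtain k where k: "of_int e * (u \<bullet> (W *v u)) = of_int k" using q by (elim Ints_cases)
  let ?y = "of_int \<delta> *\<^sub>R (W *v u)"
  have p0: "p \<noteq> 0" using p by auto
  have "\<not> p^2 dvd \<delta>"
    using squarefree_\<delta> p by (metis not_prime_unit squarefreeD)
  then have np: "\<not> p^2 dvd \<lfloor>det S\<rfloor>" by (simp add: \<delta>_def)
  have "integral_vec ((1 / of_int p) *\<^sub>R ?y)"
  proof (rule anisotropic_mod_prime[OF S_Ints S_sym _ _ _ _ p det_S np])
    show "integral_vec (of_int e *\<^sub>R u)" using u by (simp add: integral_vec_scale)
    show "integral_vec ?y" using u by (rule \<delta>_W_integral)
    show "S *v ?y = of_int p *\<^sub>R (of_int e *\<^sub>R u)" by (simp add: matrix_vector_mult_scaleR e)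
    show "?y \<bullet> (of_int e *\<^sub>R u) = of_int p * of_int (e * k)"
      using k by (simp add: e inner_commute)
  qed
  then show ?thesis using p0 by (simp add: e)
qed

text \<open>The prime \<open>p\<close> divides the exponent of the discriminant group. Bezout
  removes the factor \<open>c\<close>; if \<open>e W\<close> were integral,
  \<open>det (e W) * det S = e ^ n\<close> would make \<delta>, hence \<open>p\<close>, divide a
  power of \<open>e\<close>, against squarefreeness.\<close>

lemma dual_lattice_not_refined:
  assumes p: "prime p" and e: "\<delta> = p * e" and c: "coprime c p"
  shows "\<exists>b :: int^'n. \<not> integral_vec (of_int (c * e) *\<^sub>R (W *v int_vec b))"
proof (rule ccontr)
  assume "\<not> ?thesis"
  then have ce: "integral_vec (of_int (c * e) *\<^sub>R (W *v int_vec b))" for b by blast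
  obtain r s where rs: "r * c + s * p = 1"
    using c by (metis bezout_int coprime_iff_gcd_eq_1)
  have "integral_vec (of_int e *\<^sub>R (W *v int_vec b))" for b
  proof -
    have "of_int e *\<^sub>R (W *v int_vec b) = of_int ((r * c + s * p) * e) *\<^sub>R (W *v int_vec b)"
      by (simp add: rs)
    also have "\<dots> = of_int r *\<^sub>R (of_int (c * e) *\<^sub>R (W *v int_vec b))
        + of_int s *\<^sub>R (of_int \<delta> *\<^sub>R (W *v int_vec b))"
      by (simp add: e algebra_simps scaleR_left_distrib)
    finally show ?thesis
      using ce[of b] \<delta>_W_integral[of "int_vec b"]
      by (simp only: integral_vec_add integral_vec_scale Ints_of_int integral_int_vec)
  qed
  moreover have ax: "int_vec (axis j 1) = (axis j 1 :: real^'n)" for j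
    by (simp add: int_vec_def axis_def vec_eq_iff)
  ultimately have "integral_vec (of_int e *\<^sub>R (W *v axis j 1))" for j by metis
  then have "(of_int e *\<^sub>R W)$i$j \<in> \<int>" for i j
    by (simp add: matrix_vector_mult_basis column_def integral_vec_def)
  then obtain l where l: "det (of_int e *\<^sub>R W) = of_int l" by (metis Ints_cases det_in_Ints)
  have "det (of_int e *\<^sub>R W) * det S = det ((of_int e *\<^sub>R W) ** S)" by (rule det_mul[symmetric])
  also have "\<dots> = det (of_int e *\<^sub>R (mat 1 :: real^'n^'n))"
    by (simp only: scalar_matrix_assoc[symmetric] W_S)
  also have "\<dots> = of_int (e ^ CARD('n))"
    by (subst det_diagonal) (simp_all add: mat_def)
  finally have "real_of_int (l * \<lfloor>det S\<rfloor>) = of_int (e ^ CARD('n))" using det_S l by simp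
  then have "\<lfloor>det S\<rfloor> dvd e ^ CARD('n)" by (metis dvd_triv_right of_int_eq_iff)
  then have "p dvd e ^ CARD('n)" using e by (metis \<delta>_def abs_dvd_iff dvd_mult_left)
  then have "p dvd e" using p by (rule prime_dvd_power[rotated])
  then have "p^2 dvd \<delta>" by (simp add: e power2_eq_square)
  then show False using squarefree_\<delta> p by (metis not_prime_unit squarefreeD)
qed

section \<open>The level and the denominators of the discriminant form\<close>

lemma matrix_inv_T: "matrix_inv T = 2 *\<^sub>R W"
proof -
  have 1: "T ** (2 *\<^sub>R W) = mat 1"
    using S_W by (simp add: S_def matrix_scalar_ac scalar_matrix_assoc)
  then have 2: "(2 *\<^sub>R W) ** T = mat 1" by (rule matrix_left_right_inverse1)
  have "T ** matrix_inv T = mat 1 \<and> matrix_inv T ** T = mat 1"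
    unfolding matrix_inv_def by (rule someI_ex) (use 1 2 in blast)
  then show ?thesis using 1 by (metis matrix_mul_assoc matrix_mul_lid matrix_mul_rid)
qed

lemma qform_half: "qform (matrix_inv T) ((1/2) *\<^sub>R u) = u \<bullet> (W *v u) / 2"
  by (simp add: qform_eq_inner matrix_inv_T matrix_vector_mult_scaleR
      scaleR_matrix_vector_assoc[symmetric])

text \<open>The candidate for the level: the absolute discriminant for even n and four times it for
  odd n.\<close>

definition L :: int where "L = (if even CARD('n) then \<delta> else 2 * \<delta>)"

lemma L_pos: "L > 0" using \<delta>_pos by (simp add: L_def)

text \<open>\<open>\<delta> W\<close> is integral, and for odd n doubling makes it even. For even n,
  half the value of the even matrix \<open>S\<close> at \<delta> times the i-th column of
  \<open>W\<close> is \<open>\<delta> * (\<delta> * W$i$i) / 2\<close>, and \<delta> is odd.\<close>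

lemma even_matrix_L_W: "even_matrix (of_int L *\<^sub>R W)"
proof -
  have col: "W$i$j = (W *v axis j 1)$i" for i j
    by (simp add: matrix_vector_mult_basis column_def)
  have ints: "of_int \<delta> * W$i$j \<in> \<int>" for i j
    using \<delta>_W_integral[OF integral_vec_axis[of j]] by (simp add: integral_vec_def col)
  have diag: "of_int \<delta> * W$i$i / 2 \<in> \<int>" if n: "even CARD('n)" for i
  proof -
    let ?u = "of_int \<delta> *\<^sub>R (W *v axis i 1)"
    obtain k where k: "of_int \<delta> * W$i$i = of_int k"
      using ints[of i i] by (elim Ints_cases)
    have "?u \<bullet> (S *v ?u) / 2 \<in> \<int>"
      by (intro even_matrix_qform even_matrix_S S_sym \<delta>_W_integral integral_vec_axis)
    also have "?u \<bullet> (S *v ?u) = of_int \<delta> * (of_int \<delta> * W$i$i)"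
      by (simp add: matrix_vector_mult_scaleR inner_axis col)
    finally have "of_int (\<delta> * k) / 2 \<in> (\<int> :: real set)" by (simp add: k)
    then obtain l where "real_of_int (\<delta> * k) / 2 = of_int l" by (elim Ints_cases)
    then have "\<delta> * k = 2 * l" by linarith
    then have "even (\<delta> * k)" by simp
    then have "even k" using odd_\<delta>[OF n] by simp
    then show ?thesis unfolding k by (elim evenE) simp
  qed
  have L2: "of_int (2 * \<delta>) * W$i$j = 2 * (of_int \<delta> * W$i$j)" for i j by simp
  show ?thesis
  proof (cases "even CARD('n)")
    case True
    then show ?thesis using ints diag by (simp add: even_matrix_def L_def)
  next
    case False
    have "2 * (of_int \<delta> * W$i$j) \<in> \<int>" for i j by (intro Ints_mult ints) simp
    with False show ?thesis using ints by (simp add: even_matrix_def L_def mult.assoc)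
  qed
qed

lemma scaleR_W_sym: "transpose (c *\<^sub>R W) = c *\<^sub>R W"
  by (simp only: transpose_scalar W_sym)

lemma scaleR_W_q: "u \<bullet> ((c *\<^sub>R W) *v u) / 2 = c * (u \<bullet> (W *v u) / 2)"
  by (simp add: scaleR_matrix_vector_assoc[symmetric])

lemma L_q_Ints:
  assumes "integral_vec u"
  shows "of_int L * (u \<bullet> (W *v u) / 2) \<in> \<int>"
  using even_matrix_qform[OF even_matrix_L_W scaleR_W_sym assms] by (simp only: scaleR_W_q)

lemma q_Rats: "integral_vec u \<Longrightarrow> u \<bullet> (W *v u) / 2 \<in> \<rat>"
  using in_Rats_if_mult_in_Ints[OF L_q_Ints] L_pos by auto

lemma denominator_le_L: "integral_vec u \<Longrightarrow> denominator (u \<bullet> (W *v u) / 2) \<le> L"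
  using L_q_Ints denominator_dvd_iff[OF q_Rats] L_pos zdvd_imp_le by blast

text \<open>For a prime \<open>p\<close> dividing \<open>L\<close>, integrality of
  \<open>L div p\<close> times the value would give integrality of
  \<open>e * (u \<bullet> (W *v u))\<close> with \<open>e = \<delta> div p\<close>, and
  \<open>anisotropic\<close> then contradicts \<open>prim\<close>.\<close>

lemma denominator_eq_L:
  assumes u: "integral_vec u"
    and prim: "\<And>p. prime p \<Longrightarrow> p dvd \<delta> \<Longrightarrow> \<not> integral_vec (of_int (\<delta> div p) *\<^sub>R (W *v u))"
  shows "denominator (u \<bullet> (W *v u) / 2) = L"
proof (rule denominator_eqI[OF q_Rats[OF u] L_pos L_q_Ints[OF u]])
  fix p assume p: "prime p" and "p dvd L"
  \<comment> \<open>For odd n the additional prime 2 of \<open>L\<close> already divides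
    \<delta>.\<close>
  then have p\<delta>: "p dvd \<delta>"
    using even_\<delta> primes_dvd_imp_eq[of p 2]
    by (auto simp: L_def prime_dvd_mult_iff split: if_splits)
  then obtain e where e: "\<delta> = p * e" by (elim dvdE)
  have p0: "p \<noteq> 0" using p by auto
  show "of_int (L div p) * (u \<bullet> (W *v u) / 2) \<notin> \<int>"
  proof
    assume *: "of_int (L div p) * (u \<bullet> (W *v u) / 2) \<in> \<int>"
    have "L div p = e \<or> L div p = 2 * e" using e p0 by (auto simp: L_def)
    then have "of_int e * (u \<bullet> (W *v u)) \<in> \<int>"
    proof
      assume "L div p = e"
      moreover have "2 * (of_int (L div p) * (u \<bullet> (W *v u) / 2)) \<in> \<int>"
        by (rule Ints_mult[OF _ *]) simp
      ultimately show ?thesis by simp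
    qed (use * in simp)
    then have "integral_vec (of_int e *\<^sub>R (W *v u))" by (rule anisotropic[OF p e u])
    moreover have "\<delta> div p = e" using e p0 by simp
    ultimately show False using prim[OF p p\<delta>] by simp
  qed
qed

text \<open>Evenness of \<open>l W\<close> makes \<open>l\<close> times every value of the form
  integral, so a single value with denominator \<open>L\<close> shows that \<open>L\<close> divides
  every such \<open>l\<close>.\<close>

lemma lvl_eq_L:
  assumes u: "integral_vec u" and den: "denominator (u \<bullet> (W *v u) / 2) = L"
  shows "int (lvl T) = L"
proof -
  have "lvl T = nat L"
    unfolding lvl_def
  proof (rule Least_equality)
    show "0 < nat L \<and> even_matrix (real (nat L) *\<^sub>R matrix_inv (2 *\<^sub>R T))"
      using L_pos even_matrix_L_W by (simp add: W_def S_def)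
  next
    fix l :: nat assume l: "0 < l \<and> even_matrix (real l *\<^sub>R matrix_inv (2 *\<^sub>R T))"
    then have "even_matrix (real l *\<^sub>R W)" by (simp add: W_def S_def)
    from even_matrix_qform[OF this scaleR_W_sym u]
    have "of_int (int l) * (u \<bullet> (W *v u) / 2) \<in> \<int>"
      by (simp only: scaleR_W_q of_int_of_nat_eq)
    then have "L dvd int l" by (simp only: denominator_dvd_iff[OF q_Rats[OF u]] den)
    then show "nat L \<le> l" using l zdvd_imp_le[of L "int l"] by simp
  qed
  then show ?thesis using L_pos by simp
qed

end

section \<open>Translations and the action of lower unipotent matrices\<close>

definition e2pi :: "complex \<Rightarrow> complex" where
  "e2pi x = exp (2 * of_real pi * \<i> * x)"

lemma e2pi_nonzero [simp]: "e2pi x \<noteq> 0"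
  by (simp add: e2pi_def)

lemma e2pi_add: "e2pi (x + y) = e2pi x * e2pi y"
  by (simp add: e2pi_def distrib_left exp_add)

lemma e2pi_eq_1_iff: "e2pi (of_real r) = 1 \<longleftrightarrow> r \<in> \<int>"
proof -
  have "e2pi (of_real r) = 1 \<longleftrightarrow> (\<exists>n::int. 2 * pi * r = of_int (2 * n) * pi)"
    by (simp add: e2pi_def exp_eq_1)
  also have "\<dots> \<longleftrightarrow> (\<exists>n::int. r = of_int n)" by (simp add: mult.commute)
  also have "\<dots> \<longleftrightarrow> r \<in> \<int>" by (auto elim: Ints_cases)
  finally show ?thesis .
qed

lemma e2pi_Ints_diff:
  assumes "r - s \<in> \<int>"
  shows "e2pi (of_real r) = e2pi (of_real s)"
  using assms e2pi_add[of "of_real s" "of_real (r - s)"] e2pi_eq_1_iff[of "r - s"] by simp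

section \<open>Bilinear and quadratic forms on complex vectors\<close>

definition cvec :: "real^'n \<Rightarrow> complex^'n" where
  "cvec v = (\<chi> i. of_real (v$i))"

lemma cvec_add: "cvec (u + v) = cvec u + cvec v"
  and cvec_scaleR: "cvec (r *\<^sub>R u) = of_real r *s cvec u"
  and cvec_int_vec: "int_vec m = cvec (int_vec m)"
  by (simp_all add: cvec_def int_vec_def vec_eq_iff)

lemma bform_add_left: "bform A (x + y) z = bform A x z + bform A y z"
  and bform_add_right: "bform A x (y + z) = bform A x y + bform A x z"
  by (simp_all add: bform_def algebra_simps sum.distrib)

lemma bform_scale_left: "bform A (c *s x) y = c * bform A x (y :: complex^'n)"
  and bform_scale_right: "bform A x (c *s y) = c * bform A x (y :: complex^'n)"
  by (simp_all add: bform_def sum_distrib_left ac_simps)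

lemma bform_commute:
  fixes x y :: "complex^'n"
  assumes "transpose A = A"
  shows "bform A x y = bform A y x"
proof -
  have "A$i$j = A$j$i" for i j
  proof -
    have "A$i$j = transpose A$i$j" by (simp only: assms)
    then show ?thesis by (simp only: transpose_def vec_lambda_beta)
  qed
  then show ?thesis
    unfolding bform_def by (subst sum.swap) (simp add: ac_simps)
qed

lemma bform_cvec: "bform A (cvec u) (cvec v) = of_real (u \<bullet> (A *v v))"
  by (simp add: bform_def cvec_def inner_vec_def matrix_vector_mult_def sum_distrib_left mult.assoc)

lemma qform_add:
  fixes x y :: "complex^'n"
  assumes "transpose A = A"
  shows "qform A (x + y) = qform A x + 2 * bform A x y + qform A y"
  using bform_commute[OF assms, of x y]
  by (simp add: qform_def bform_add_left bform_add_right)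

lemma qform_scale: "qform A (c *s x) = c^2 * qform A (x :: complex^'n)"
  by (simp add: qform_def bform_scale_left bform_scale_right power2_eq_square)

text \<open>Independence of characters. If \<open>\<eta> C\<^sub>1 b\<close> differs from
  \<open>\<eta>\<^sub>0 b\<close>, shifting the relation by \<open>w b\<close> and subtracting
  \<open>\<eta> C\<^sub>1 b\<close> times the original removes \<open>C\<^sub>1\<close> and rescales
  the wanted part by a nonzero factor.\<close>

lemma isotypic_sum_eq_0:
  fixes g :: "'c \<Rightarrow> 'v::plus \<Rightarrow> complex"
  assumes "finite K"
    and "\<And>C b z. C \<in> K \<Longrightarrow> g C (z + w b) = \<eta> C b * g C z"
    and "\<And>z. (\<Sum>C\<in>K. g C z) = 0"
  shows "(\<Sum>C\<in>{C \<in> K. \<eta> C = \<eta>\<^sub>0}. g C z) = 0"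
  using assms
proof (induction K arbitrary: g z rule: finite_psubset_induct)
  case (psubset K)
  show ?case
  proof (cases "\<forall>C\<in>K. \<eta> C = \<eta>\<^sub>0")
    case True
    then have "{C \<in> K. \<eta> C = \<eta>\<^sub>0} = K" by blast
    then show ?thesis using psubset.prems by simp
  next
    case False
    then obtain C\<^sub>1 b where C: "C\<^sub>1 \<in> K" and b: "\<eta> C\<^sub>1 b \<noteq> \<eta>\<^sub>0 b" by (metis ext)
    let ?g = "\<lambda>C z. (\<eta> C b - \<eta> C\<^sub>1 b) * g C z"
    have "(\<Sum>C\<in>K - {C\<^sub>1}. ?g C z) = 0" for z
    proof -
      have "(\<Sum>C\<in>K - {C\<^sub>1}. ?g C z) = (\<Sum>C\<in>K. ?g C z)"
        using psubset.hyps C by (simp add: sum.remove)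
      also have "\<dots> = (\<Sum>C\<in>K. g C (z + w b)) - \<eta> C\<^sub>1 b * (\<Sum>C\<in>K. g C z)"
        using psubset.prems(1)
        by (simp add: left_diff_distrib sum_subtractf sum_distrib_left)
      finally show ?thesis by (simp add: psubset.prems(2))
    qed
    moreover have "?g C (z + w b') = \<eta> C b' * ?g C z" if "C \<in> K - {C\<^sub>1}" for C b' z
      using psubset.prems(1) that by simp
    ultimately have "(\<Sum>C\<in>{C \<in> K - {C\<^sub>1}. \<eta> C = \<eta>\<^sub>0}. ?g C z) = 0"
      using psubset.IH[of "K - {C\<^sub>1}" ?g] C by blast
    moreover have "{C \<in> K - {C\<^sub>1}. \<eta> C = \<eta>\<^sub>0} = {C \<in> K. \<eta> C = \<eta>\<^sub>0}" using b by auto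
    moreover have "(\<Sum>C\<in>{C \<in> K. \<eta> C = \<eta>\<^sub>0}. ?g C z)
        = (\<eta>\<^sub>0 b - \<eta> C\<^sub>1 b) * (\<Sum>C\<in>{C \<in> K. \<eta> C = \<eta>\<^sub>0}. g C z)"
      by (simp add: sum_distrib_left)
    ultimately show ?thesis using b by simp
  qed
qed

section \<open>Lower unipotent matrices\<close>

definition lower :: "int \<Rightarrow> int^2^2" where
  "lower c = vector [vector [1, 0], vector [c, 1]]"

lemma lower_nth [simp]:
  "lower c$1$1 = 1" "lower c$1$2 = 0" "lower c$2$1 = c" "lower c$2$2 = 1"
  by (simp_all add: lower_def)

lemma lower_in_Gamma0: "int N dvd c \<Longrightarrow> lower c \<in> Gamma0 N"
  by (simp add: Gamma0_def SL2Z_def det_2)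

lemma slash_lower:
  "slash k A (lower c) F \<tau> z =
     F (\<tau> / (of_int c * \<tau> + 1)) ((1 / (of_int c * \<tau> + 1)) *s z)
       * (of_int c * \<tau> + 1) powi (- k) * e2pi (- (of_int c * qform A z / (of_int c * \<tau> + 1)))"
  by (simp add: slash_def e2pi_def Let_def mult.assoc)

lemma lower_moebius:
  assumes "\<tau> \<in> upper_half_plane"
  shows "of_int c * \<tau> + 1 \<noteq> 0" and "\<tau> / (of_int c * \<tau> + 1) \<in> upper_half_plane"
proof -
  show "of_int c * \<tau> + 1 \<noteq> 0"
  proof
    assume eq: "of_int c * \<tau> + 1 = 0"
    then have "of_int c * Im \<tau> = 0" by (auto simp: complex_eq_iff)
    then show False using assms eq by (auto simp: upper_half_plane_def)
  qed
  have "Im (\<tau> * cnj (of_int c * \<tau> + 1)) = Im \<tau>" by (simp add: algebra_simps)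
  then show "\<tau> / (of_int c * \<tau> + 1) \<in> upper_half_plane"
    using assms by (simp add: upper_half_plane_def Im_complex_div_gt_0)
qed

section \<open>Classes modulo 2T\<int>^n and their representatives\<close>

lemma equiv_coset_rel:
  fixes T :: "real^'n^'n"
  shows "equiv UNIV (coset_rel T)"
proof (rule equivI)
  show "refl (coset_rel T)"
    by (rule reflI) (auto simp: coset_rel_def intro!: exI[of _ 0] simp: int_vec_def vec_eq_iff matrix_vector_mult_def)
  show "sym (coset_rel T)"
  proof (rule symI)
    fix \<mu> \<nu> assume "(\<mu>, \<nu>) \<in> coset_rel T"
    then obtain x where "(int_vec \<nu> :: real^'n) = int_vec \<mu> + (2 *\<^sub>R T) *v int_vec x"
      by (auto simp: coset_rel_def)
    moreover have "int_vec (- x) = (- int_vec x :: real^'n)" by (simp add: int_vec_def vec_eq_iff)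
    moreover have "(2 *\<^sub>R T) *v (- int_vec x) = - ((2 *\<^sub>R T) *v int_vec x)"
      using matrix_vector_mult_scaleR[of "2 *\<^sub>R T" "-1" "int_vec x"] by simp
    ultimately have "(int_vec \<mu> :: real^'n) = int_vec \<nu> + (2 *\<^sub>R T) *v int_vec (- x)" by simp
    then show "(\<nu>, \<mu>) \<in> coset_rel T" unfolding coset_rel_def by blast
  qed
  show "trans (coset_rel T)"
  proof (rule transI)
    fix \<mu> \<nu> \<kappa> assume "(\<mu>, \<nu>) \<in> coset_rel T" "(\<nu>, \<kappa>) \<in> coset_rel T"
    then obtain x y where "(int_vec \<nu> :: real^'n) = int_vec \<mu> + (2 *\<^sub>R T) *v int_vec x"
      "(int_vec \<kappa> :: real^'n) = int_vec \<nu> + (2 *\<^sub>R T) *v int_vec y"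
      by (auto simp: coset_rel_def)
    moreover have "int_vec (x + y) = (int_vec x + int_vec y :: real^'n)"
      by (simp add: int_vec_def vec_eq_iff)
    ultimately have "(int_vec \<kappa> :: real^'n) = int_vec \<mu> + (2 *\<^sub>R T) *v int_vec (x + y)"
      by (simp add: matrix_vector_right_distrib)
    then show "(\<mu>, \<kappa>) \<in> coset_rel T" unfolding coset_rel_def by blast
  qed
qed auto

text \<open>Repeats the choice made in \<open>theta_decomposition\<close>, so that the two agree by
  unfolding.\<close>

definition rep :: "(int^'n) set \<Rightarrow> int^'n" where
  "rep C = (SOME \<mu>. \<mu> \<in> C)"

lemma rep_in: "C \<in> cosets T \<Longrightarrow> rep C \<in> C"
  unfolding rep_def cosets_def
  using in_quotient_imp_non_empty[OF equiv_coset_rel] by (metis ex_in_conv someI_ex)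

lemma coset_rep: "C \<in> cosets T \<Longrightarrow> coset T (rep C) = C"
  using rep_in[of C T] unfolding cosets_def coset_def
  by (metis Image_singleton_iff equiv_class_eq equiv_coset_rel quotientE)

text \<open>Only the shifts by \<tau> m of the elliptic law; real shifts are recorded separately as
  eigenvalues.\<close>

definition lattice_periodic :: "real^'n^'n \<Rightarrow> (complex \<Rightarrow> complex^'n \<Rightarrow> complex) \<Rightarrow> bool" where
  "lattice_periodic A F \<longleftrightarrow> (\<forall>\<tau>\<in>upper_half_plane. \<forall>z m.
     F \<tau> (z + \<tau> *s int_vec m) = e2pi (- (qform A (int_vec m) * \<tau> + 2 * bform A (int_vec m) z)) * F \<tau> z)"

text \<open>Division of \<open>z\<close> by \<open>c \<tau> + 1\<close> turns the shift by
  \<open>(c \<tau> + 1) v\<close> into the shift by \<open>v\<close>; the exponential is the change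
  of the quadratic factor of the slash action.\<close>

lemma slash_lower_shift:
  assumes sym: "transpose A = A" and \<tau>: "\<tau> \<in> upper_half_plane" and F: "\<And>z. F (\<tau> / (of_int c * \<tau> + 1)) (z + v) = a * F (\<tau> / (of_int c * \<tau> + 1)) z"
  shows "slash k A (lower c) F \<tau> (z + (of_int c * \<tau> + 1) *s v) =
    a * e2pi (- (of_int c * (2 * bform A v z + qform A v * (of_int c * \<tau> + 1)))) * slash k A (lower c) F \<tau> z"
proof -
  define J where "J = of_int c * \<tau> + 1"
  have J: "J \<noteq> 0" using lower_moebius(1)[OF \<tau>] by (simp add: J_def)
  have 1: "(1 / J) *s (z + J *s v) = (1 / J) *s z + v" using J by (simp add: vec_eq_iff field_simps)
  have "qform A (z + J *s v) = qform A z + J * (2 * bform A v z + qform A v * J)"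
    using bform_commute[OF sym, of z v]
    by (simp add: qform_add[OF sym] bform_scale_right qform_scale algebra_simps power2_eq_square)
  then have 2: "- (of_int c * qform A (z + J *s v) / J)
      = - (of_int c * (2 * bform A v z + qform A v * J)) + - (of_int c * qform A z / J)"
    using J by (simp add: field_simps)
  show ?thesis
    unfolding slash_lower J_def[symmetric] 1 2 e2pi_add using F by (simp add: J_def)
qed

text \<open>With J = c \<tau> + 1, the shift by \<tau> m becomes a shift by (\<tau>/J) m at the
  transformed point \<tau>/J, and the exponents combine by the definition of J.\<close>

lemma lattice_periodic_slash_lower:
  fixes A :: "real^'n^'n"
  assumes sym: "transpose A = A" and F: "lattice_periodic A F"
  shows "lattice_periodic A (slash k A (lower c) F)"
  unfolding lattice_periodic_def
proof (intro ballI allI)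
  fix \<tau> z m assume \<tau>: "\<tau> \<in> upper_half_plane"
  define J where "J = of_int c * \<tau> + 1"
  define x where "x = (int_vec m :: complex^'n)"
  have J: "J \<noteq> 0" using lower_moebius(1)[OF \<tau>] by (simp add: J_def)
  have 1: "(1 / J) *s (z + \<tau> *s x) = (1 / J) *s z + (\<tau> / J) *s x"
    using J by (simp add: vec_eq_iff field_simps)
  have 2: "F (\<tau> / J) ((1 / J) *s z + (\<tau> / J) *s x)
      = e2pi (- (qform A x * (\<tau> / J) + 2 * bform A x ((1 / J) *s z))) * F (\<tau> / J) ((1 / J) *s z)"
    using F lower_moebius(2)[OF \<tau>, of c] by (simp add: lattice_periodic_def x_def J_def)
  have q: "qform A (z + \<tau> *s x) = qform A z + 2 * \<tau> * bform A x z + \<tau>^2 * qform A x"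
    using bform_commute[OF sym, of z x]
    by (simp add: qform_add[OF sym] bform_scale_right qform_scale)
  have "- (qform A x * (\<tau> / J) + 2 * bform A x ((1 / J) *s z)) + - (of_int c * qform A (z + \<tau> *s x) / J)
     = - ((qform A x * \<tau> + 2 * bform A x z) * J / J) + - (of_int c * qform A z / J)"
    unfolding q bform_scale_right by (simp add: J_def algebra_simps add_divide_distrib power2_eq_square)
  also have "\<dots> = - (qform A x * \<tau> + 2 * bform A x z) + - (of_int c * qform A z / J)"
    using J by simp
  finally have 3: "e2pi (- (qform A x * (\<tau> / J) + 2 * bform A x ((1 / J) *s z))) * e2pi (- (of_int c * qform A (z + \<tau> *s x) / J))
      = e2pi (- (qform A x * \<tau> + 2 * bform A x z)) * e2pi (- (of_int c * qform A z / J))"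
    by (simp only: e2pi_add[symmetric])
  show "slash k A (lower c) F \<tau> (z + \<tau> *s int_vec m) =
      e2pi (- (qform A (int_vec m) * \<tau> + 2 * bform A (int_vec m) z)) * slash k A (lower c) F \<tau> z"
    unfolding slash_lower J_def[symmetric] x_def[symmetric] 1 2 using 3 by (simp add: ac_simps)
qed

text \<open>In the Heisenberg group \<open>lower c\<close> carries the translation \<open>(0, v)\<close> to \<open>(c v, v)\<close>, which
  acts like \<open>(0, v)\<close> as soon as \<open>c v\<close> is integral; the cocycle is \<open>e2pi (c A[v])\<close>.\<close>

lemma slash_lower_eigen:
  assumes sym: "transpose A = A" and F: "lattice_periodic A F"
    and eig: "\<And>\<tau> z. \<tau> \<in> upper_half_plane \<Longrightarrow> F \<tau> (z + cvec v) = a * F \<tau> z"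
    and cv: "integral_vec (of_int c *\<^sub>R v)" and q: "of_int c * (v \<bullet> (A *v v)) \<in> \<int>"
    and \<tau>: "\<tau> \<in> upper_half_plane"
  shows "slash k A (lower c) F \<tau> (z + cvec v) = a * slash k A (lower c) F \<tau> z"
proof -
  let ?G = "slash k A (lower c) F"
  obtain m where m: "of_int c *\<^sub>R v = int_vec m" using integral_vecE[OF cv] by blast
  have x: "int_vec m = of_int c *s cvec v"
    using cvec_scaleR[of "of_int c" v] by (simp add: cvec_int_vec m[symmetric])
  \<comment> \<open>This point is reached from \<open>z + cvec v\<close> by a lattice shift and from
    \<open>z\<close> by \<open>slash_lower_shift\<close>; comparing the two factors gives the
    eigenvalue.\<close>
  have eq: "z + (of_int c * \<tau> + 1) *s cvec v = (z + cvec v) + \<tau> *s int_vec m"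
    by (simp add: x vec_eq_iff algebra_simps)
  have "?G \<tau> (z + (of_int c * \<tau> + 1) *s cvec v)
      = e2pi (- (qform A (int_vec m) * \<tau> + 2 * bform A (int_vec m) (z + cvec v))) * ?G \<tau> (z + cvec v)"
    unfolding eq using lattice_periodic_slash_lower[OF sym F] \<tau> unfolding lattice_periodic_def by blast
  moreover have "?G \<tau> (z + (of_int c * \<tau> + 1) *s cvec v) =
     a * e2pi (- (of_int c * (2 * bform A (cvec v) z + qform A (cvec v) * (of_int c * \<tau> + 1)))) * ?G \<tau> z"
    by (rule slash_lower_shift[OF sym \<tau>]) (rule eig[OF lower_moebius(2)[OF \<tau>]])
  moreover have "- (of_int c * (2 * bform A (cvec v) z + qform A (cvec v) * (of_int c * \<tau> + 1)))
      = - (qform A (int_vec m) * \<tau> + 2 * bform A (int_vec m) (z + cvec v)) + of_int c * qform A (cvec v)"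
    by (simp add: x bform_scale_left bform_scale_right bform_add_right qform_def algebra_simps)
  moreover have "e2pi (of_int c * qform A (cvec v)) = 1"
    using q e2pi_eq_1_iff[of "of_int c * (v \<bullet> (A *v v))"] by (simp add: qform_def bform_cvec)
  ultimately show ?thesis by (simp add: e2pi_add)
qed

section \<open>Theta components\<close>

context fundamental_index
begin

lemma T_W: "2 * (u \<bullet> (T *v (W *v v))) = u \<bullet> v"
proof -
  have "u \<bullet> (S *v (W *v v)) = 2 * (u \<bullet> (T *v (W *v v)))"
    unfolding S_def by (simp only: scaleR_matrix_vector_assoc[symmetric] inner_scaleR_right)
  then show ?thesis by simp
qed

lemma bform_T_W: "2 * bform T (cvec u) (cvec (W *v v)) = of_real (u \<bullet> v)"
  unfolding bform_cvec using T_W[of u v] by (metis of_real_mult of_real_numeral)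

lemma coset_relI:
  assumes "integral_vec (W *v (int_vec \<nu> - int_vec \<mu>))"
  shows "(\<mu>, \<nu>) \<in> coset_rel T"
proof -
  obtain x where "W *v (int_vec \<nu> - int_vec \<mu>) = int_vec x" using integral_vecE[OF assms] by blast
  then have "int_vec \<nu> - int_vec \<mu> = S *v int_vec x" by (metis S_W_vec)
  then have "int_vec \<nu> = int_vec \<mu> + (2 *\<^sub>R T) *v int_vec x" by (simp add: S_def algebra_simps)
  then show ?thesis by (auto simp: coset_rel_def)
qed

lemma jacobi_theta_eq:
  "jacobi_theta T \<mu> \<tau> z = (\<Sum>\<^sub>\<infinity>l. e2pi (qform T (cvec (int_vec l + W *v int_vec \<mu>)) * \<tau>
     + 2 * bform T (cvec (int_vec l + W *v int_vec \<mu>)) z))"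
  by (simp add: jacobi_theta_def e2pi_def cvec_def W_def S_def Let_def)

text \<open>The shift multiplies the term of index \<open>l\<close> by
  \<open>e2pi ((l + W \<mu>) \<bullet> a)\<close>, where \<open>l \<bullet> a\<close> is an integer.
  This common factor can be pulled out of the infinite sum whether or not it converges.\<close>

lemma jacobi_theta_dual_shift:
  assumes a: "integral_vec a"
  shows "jacobi_theta T \<mu> \<tau> (z + cvec (W *v a)) = e2pi (of_real ((W *v int_vec \<mu>) \<bullet> a)) * jacobi_theta T \<mu> \<tau> z"
proof -
  have "e2pi (qform T (cvec (int_vec l + W *v int_vec \<mu>)) * \<tau>
        + 2 * bform T (cvec (int_vec l + W *v int_vec \<mu>)) (z + cvec (W *v a)))
      = e2pi (of_real ((W *v int_vec \<mu>) \<bullet> a)) * e2pi (qform T (cvec (int_vec l + W *v int_vec \<mu>)) * \<tau>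
        + 2 * bform T (cvec (int_vec l + W *v int_vec \<mu>)) z)" for l
  proof -
    have "e2pi (of_real ((int_vec l + W *v int_vec \<mu>) \<bullet> a)) = e2pi (of_real ((W *v int_vec \<mu>) \<bullet> a))"
      by (rule e2pi_Ints_diff) (simp add: inner_add_left integral_vec_inner a)
    then show ?thesis
      by (simp add: bform_add_right distrib_left bform_T_W e2pi_add)
  qed
  then show ?thesis unfolding jacobi_theta_eq by (simp add: infsum_cmult_right')
qed

text \<open>Completing the square turns the shift by \<tau> m into the bijection
  \<open>l \<mapsto> l + m\<close> of the index set.\<close>

lemma jacobi_theta_periodic: "lattice_periodic T (jacobi_theta T \<mu>)"
  unfolding lattice_periodic_def
proof (intro ballI allI)
  fix \<tau> z m
  define f where "f = (\<lambda>l. e2pi (qform T (cvec (int_vec l + W *v int_vec \<mu>)) * \<tau>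
      + 2 * bform T (cvec (int_vec l + W *v int_vec \<mu>)) z))"
  define a where "a = e2pi (- (qform T (int_vec m) * \<tau> + 2 * bform T (int_vec m) z))"
  have "e2pi (qform T (cvec (int_vec l + W *v int_vec \<mu>)) * \<tau>
        + 2 * bform T (cvec (int_vec l + W *v int_vec \<mu>)) (z + \<tau> *s int_vec m)) = a * f (l + m)" for l
  proof -
    let ?v = "cvec (int_vec l + W *v int_vec \<mu>)"
    have "int_vec (l + m) + W *v int_vec \<mu> = (int_vec l + W *v int_vec \<mu>) + int_vec m"
      by (simp add: int_vec_def vec_eq_iff)
    then have "cvec (int_vec (l + m) + W *v int_vec \<mu>) = ?v + int_vec m"
      by (simp add: cvec_add cvec_int_vec[symmetric])
    then show ?thesis
      using bform_commute[OF T_sym, of "int_vec m" ?v]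
      by (simp add: f_def a_def e2pi_add[symmetric] qform_add[OF T_sym] bform_add_left
          bform_add_right bform_scale_right algebra_simps)
  qed
  then have "jacobi_theta T \<mu> \<tau> (z + \<tau> *s int_vec m) = a * (\<Sum>\<^sub>\<infinity>l. f (l + m))"
    unfolding jacobi_theta_eq by (simp add: infsum_cmult_right')
  also have "(\<Sum>\<^sub>\<infinity>l. f (l + m)) = (\<Sum>\<^sub>\<infinity>l. f l)"
    by (rule infsum_reindex_bij_witness[of _ "\<lambda>l. l - m" "\<lambda>l. l + m"]) auto
  finally show "jacobi_theta T \<mu> \<tau> (z + \<tau> *s int_vec m) =
      e2pi (- (qform T (int_vec m) * \<tau> + 2 * bform T (int_vec m) z)) * jacobi_theta T \<mu> \<tau> z"
    unfolding a_def f_def jacobi_theta_eq .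
qed

text \<open>The primes at which the component of \<open>\<mu>\<close> in the discriminant group vanishes.\<close>

definition bad_primes :: "int^'n \<Rightarrow> int set" where
  "bad_primes \<mu> = {p. prime p \<and> p dvd \<delta> \<and> integral_vec (of_int (\<delta> div p) *\<^sub>R (W *v int_vec \<mu>))}"

lemma finite_bad_primes: "finite (bad_primes \<mu>)"
  by (rule finite_subset[of _ "{p. p dvd \<delta>}"]) (use \<delta>_pos in \<open>auto simp: bad_primes_def\<close>)

lemma prime_cofactor_coprime:
  assumes "prime p" "\<delta> = p * e"
  shows "coprime e p"
proof -
  have "\<not> p dvd e"
  proof
    assume "p dvd e"
    then have "p^2 dvd \<delta>" by (simp add: assms power2_eq_square)
    then show False using squarefree_\<delta> assms(1) by (metis not_prime_unit squarefreeD)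
  qed
  then show ?thesis using assms(1) by (metis coprime_commute prime_imp_coprime)
qed

text \<open>The two classes differ by a nonzero element killed by \<open>p\<close>. At
  \<open>p\<close> the component becomes nonzero, as otherwise the coprime numbers \<open>e\<close>
  and \<open>p\<close> would both kill the difference. At another prime \<open>p'\<close> the
  multiplier \<open>\<delta> div p'\<close> is a multiple of \<open>p\<close>, so vanishing there is
  unaffected.\<close>

lemma bad_primes_psubset:
  assumes p: "p \<in> bad_primes \<mu>" and diff: "integral_vec (of_int p *\<^sub>R (W *v (int_vec \<nu> - int_vec \<mu>)))"
    and ne: "(\<mu>, \<nu>) \<notin> coset_rel T"
  shows "bad_primes \<nu> \<subset> bad_primes \<mu>"
proof -
  let ?d = "W *v (int_vec \<nu> - int_vec \<mu>) :: real^'n"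
  have d: "?d = W *v int_vec \<nu> - W *v int_vec \<mu>" by (rule matrix_vector_mult_diff_distrib)
  have pp: "prime p" and p\<delta>: "p dvd \<delta>" using p by (auto simp: bad_primes_def)
  then obtain e where e: "\<delta> = p * e" by (elim dvdE)
  have pe: "\<delta> div p = e" using e pp by auto
  have "p \<notin> bad_primes \<nu>"
  proof
    assume "p \<in> bad_primes \<nu>"
    with p have "integral_vec (of_int e *\<^sub>R (W *v int_vec \<nu>) - of_int e *\<^sub>R (W *v int_vec \<mu>))"
      by (intro integral_vec_diff) (simp_all add: bad_primes_def pe)
    then have ed: "integral_vec (of_int e *\<^sub>R ?d)" by (simp add: d scaleR_diff_right)
    obtain r s where rs: "r * e + s * p = 1"
      using prime_cofactor_coprime[OF pp e] by (metis bezout_int coprime_iff_gcd_eq_1)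
    have "?d = of_int (r * e + s * p) *\<^sub>R ?d" by (simp add: rs)
    also have "\<dots> = of_int r *\<^sub>R (of_int e *\<^sub>R ?d) + of_int s *\<^sub>R (of_int p *\<^sub>R ?d)"
      by (simp add: scaleR_left_distrib)
    finally have "integral_vec ?d"
      using ed diff by (metis Ints_of_int integral_vec_add integral_vec_scale)
    then show False using ne coset_relI by blast
  qed
  moreover have "p' \<in> bad_primes \<mu>" if p': "p' \<in> bad_primes \<nu>" for p'
  proof -
    have pp': "prime p'" and p'\<delta>: "p' dvd \<delta>" using p' by (auto simp: bad_primes_def)
    have "p \<noteq> p'" using p' \<open>p \<notin> bad_primes \<nu>\<close> by blast
    then have "coprime p p'" using pp pp' by (simp add: primes_coprime)
    moreover obtain e' where e': "\<delta> = p' * e'" using p'\<delta> by (elim dvdE)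
    ultimately have "p dvd e'" using p\<delta> by (simp add: coprime_dvd_mult_right_iff)
    then obtain f where f: "e' = p * f" by (elim dvdE)
    have pe': "\<delta> div p' = e'" using e' pp' by auto
    have "of_int e' *\<^sub>R (W *v int_vec \<mu>)
        = of_int e' *\<^sub>R (W *v int_vec \<nu>) - of_int f *\<^sub>R (of_int p *\<^sub>R ?d)"
      by (simp add: d f algebra_simps)
    moreover have "integral_vec (of_int e' *\<^sub>R (W *v int_vec \<nu>) - of_int f *\<^sub>R (of_int p *\<^sub>R ?d))"
      using p' integral_vec_scale[OF Ints_of_int diff, of f]
      by (intro integral_vec_diff) (simp_all add: bad_primes_def pe')
    ultimately show ?thesis using pp' p'\<delta> by (simp add: bad_primes_def pe')
  qed
  ultimately show ?thesis using p by blast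
qed

text \<open>The two evaluations of \<open>F \<tau> (z + W b' + (c \<tau> + 1) e W b)\<close> differ by the commutator
  \<open>e2pi (c e (W b) \<bullet> b')\<close> of the two Heisenberg translations.\<close>

lemma single_component_not_invariant:
  assumes p: "p \<in> bad_primes \<mu>" and e: "\<delta> = p * e" and c: "coprime c p"
    and eig: "\<And>\<tau> z a. \<tau> \<in> upper_half_plane \<Longrightarrow> integral_vec a \<Longrightarrow>
      F \<tau> (z + cvec (W *v a)) = e2pi (of_real ((W *v int_vec \<mu>) \<bullet> a)) * F \<tau> z"
    and inv: "\<And>\<tau> z. \<tau> \<in> upper_half_plane \<Longrightarrow> slash k T (lower c) F \<tau> z = F \<tau> z"
    and \<tau>: "\<tau> \<in> upper_half_plane"
  shows "F \<tau> z = 0"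
proof (rule ccontr)
  assume nz: "F \<tau> z \<noteq> 0"
  have pp: "prime p" using p by (auto simp: bad_primes_def)
  have pe: "\<delta> div p = e" using e pp by auto
  \<comment> \<open>Nonvanishing at a single point yields this integrality for every
    \<open>b\<close>, which \<open>dual_lattice_not_refined\<close> excludes.\<close>
  have "integral_vec (of_int (c * e) *\<^sub>R (W *v int_vec b))" for b
  proof (rule integral_vec_dual)
    fix b'
    define v where "v = W *v (of_int e *\<^sub>R int_vec b)"
    define J where "J = of_int c * \<tau> + 1"
    define X where "X = (\<lambda>z. e2pi (- (of_int c * (2 * bform T (cvec v) z + qform T (cvec v) * J))))"
    \<comment> \<open>As \<open>p\<close> is a bad prime, \<open>e W \<mu>\<close> is integral, so
      the character of \<open>F\<close> is trivial at the translation by \<open>v\<close>.\<close>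
    have per: "F \<tau> (z + cvec v) = 1 * F \<tau> z" if "\<tau> \<in> upper_half_plane" for \<tau> z
    proof -
      have "of_int e *\<^sub>R (W *v int_vec \<mu>) \<bullet> int_vec b \<in> \<int>"
        using p by (intro integral_vec_inner) (auto simp: bad_primes_def pe)
      then have "e2pi (of_real ((W *v int_vec \<mu>) \<bullet> (of_int e *\<^sub>R int_vec b))) = 1"
        by (simp only: e2pi_eq_1_iff inner_scaleR_left inner_scaleR_right)
      then show ?thesis
        using eig[OF that, of "of_int e *\<^sub>R int_vec b"] by (simp add: v_def integral_vec_scale)
    qed
    have J: "F \<tau> (z + J *s cvec v) = X z * F \<tau> z" for z
      using slash_lower_shift[OF T_sym \<tau>, of F c "cvec v" 1 k] per[OF lower_moebius(2)[OF \<tau>]] inv[OF \<tau>]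
      by (simp add: J_def X_def)
    define \<eta> where "\<eta> = e2pi (of_real ((W *v int_vec \<mu>) \<bullet> int_vec b'))"
    have E: "F \<tau> (z + cvec (W *v int_vec b')) = \<eta> * F \<tau> z" for z
      using eig[OF \<tau>, of "int_vec b'"] by (simp add: \<eta>_def)
    have "F \<tau> (z + J *s cvec v + cvec (W *v int_vec b')) = F \<tau> (z + cvec (W *v int_vec b') + J *s cvec v)"
      by (simp add: ac_simps)
    then have "X (z + cvec (W *v int_vec b')) = X z"
      using nz by (simp add: E J \<eta>_def)
    moreover have "X z = X (z + cvec (W *v int_vec b')) * e2pi (of_real (of_int c * (v \<bullet> int_vec b')))"
      by (simp add: X_def e2pi_add[symmetric] bform_add_right bform_T_W[symmetric] algebra_simps)
    ultimately have "e2pi (of_real (of_int c * (v \<bullet> int_vec b'))) = 1"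
      using e2pi_nonzero by (simp add: X_def)
    then show "of_int (c * e) *\<^sub>R (W *v int_vec b) \<bullet> int_vec b' \<in> \<int>"
      by (simp only: e2pi_eq_1_iff v_def matrix_vector_mult_scaleR inner_scaleR_left of_int_mult mult.assoc)
  qed
  then show False using dual_lattice_not_refined[OF pp e c] by blast
qed

lemma exists_primitive_component:
  assumes N: "coprime \<delta> (int N)"
    and dec: "theta_decomposition T \<phi> h"
    and inv: "\<And>c \<tau> z. int N dvd c \<Longrightarrow> \<tau> \<in> upper_half_plane \<Longrightarrow> slash k T (lower c) \<phi> \<tau> z = \<phi> \<tau> z"
    and nz: "\<exists>\<tau>\<in>upper_half_plane. \<exists>z. \<phi> \<tau> z \<noteq> 0"
  shows "\<exists>\<mu>. (\<exists>\<tau>\<in>upper_half_plane. h (coset T \<mu>) \<tau> \<noteq> 0) \<and> bad_primes \<mu> = {}"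
proof -
  define F where "F = (\<lambda>C \<tau> z. h C \<tau> * jacobi_theta T (rep C) \<tau> z)"
  define nonzero where "nonzero = (\<lambda>C. C \<in> cosets T \<and> (\<exists>\<tau>\<in>upper_half_plane. \<exists>z. F C \<tau> z \<noteq> 0))"
  have \<phi>: "\<phi> \<tau> z = (\<Sum>C\<in>cosets T. F C \<tau> z)" if "\<tau> \<in> upper_half_plane" for \<tau> z
    using dec that by (simp add: theta_decomposition_def F_def rep_def)
  \<comment> \<open>A sum over an infinite set is 0 by convention, so a nonzero
    \<open>\<phi>\<close> forces finitely many cosets.\<close>
  have fin: "finite (cosets T)"
    using nz \<phi> by (metis sum.infinite)
  have eig: "F C \<tau> (z + cvec (W *v a)) = e2pi (of_real ((W *v int_vec (rep C)) \<bullet> a)) * F C \<tau> z"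
    if "integral_vec a" for C \<tau> z a
    using jacobi_theta_dual_shift[OF that] by (simp add: F_def)
  have per: "lattice_periodic T (F C)" for C
    using jacobi_theta_periodic[of "rep C"] by (simp add: F_def lattice_periodic_def)
  have "\<exists>C. nonzero C"
  proof -
    obtain \<tau> z where \<tau>: "\<tau> \<in> upper_half_plane" and "\<phi> \<tau> z \<noteq> 0" using nz by blast
    then obtain C where "C \<in> cosets T" "F C \<tau> z \<noteq> 0" using \<phi> by (metis sum.neutral)
    then show ?thesis using \<tau> by (auto simp: nonzero_def)
  qed
  then obtain C\<^sub>0 where C\<^sub>0: "nonzero C\<^sub>0"
    and min: "\<And>C. nonzero C \<Longrightarrow> card (bad_primes (rep C\<^sub>0)) \<le> card (bad_primes (rep C))"
    using ex_has_least_nat[of nonzero _ "\<lambda>C. card (bad_primes (rep C))"] by blast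
  have C\<^sub>0_coset: "C\<^sub>0 \<in> cosets T" using C\<^sub>0 by (simp add: nonzero_def)
  have "bad_primes (rep C\<^sub>0) = {}"
  proof (rule ccontr)
    assume "bad_primes (rep C\<^sub>0) \<noteq> {}"
    then obtain p where p: "p \<in> bad_primes (rep C\<^sub>0)" by blast
    then have pp: "prime p" and p\<delta>: "p dvd \<delta>" by (auto simp: bad_primes_def)
    then obtain e where e: "\<delta> = p * e" by (elim dvdE)
    \<comment> \<open>\<open>m\<close> makes \<open>c T[w b]\<close> integral without making \<open>c\<close> divisible by \<open>p\<close>.\<close>
    define m :: int where "m = (if p = 2 then 1 else 2)"
    have m: "coprime m p" "2 dvd m * p"
      using pp primes_coprime[of 2 p] by (auto simp: m_def)
    \<comment> \<open>The factor \<open>N\<close> puts \<open>lower c\<close> into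
      \<open>Gamma0 N\<close>, and \<open>e\<close> makes \<open>c\<close> times each
      \<open>w b\<close> integral; all three factors are prime to \<open>p\<close>.\<close>
    define c where "c = int N * e * m"
    have "coprime (int N) p" using N e by (simp add: coprime_commute)
    then have c: "coprime c p" using m prime_cofactor_coprime[OF pp e] by (simp add: c_def)
    define w where "w = (\<lambda>b :: int^'n. W *v (of_int p *\<^sub>R int_vec b))"
    \<comment> \<open>These characters see the class of \<open>rep C\<close> only up to its p-part:
      equal characters mean that the difference of the classes is killed by
      \<open>p\<close>.\<close>
    define \<eta> where "\<eta> = (\<lambda>C b. e2pi (of_real ((W *v int_vec (rep C)) \<bullet> (of_int p *\<^sub>R int_vec b))))"
    have eig_p: "F C \<tau> (z + cvec (w b)) = \<eta> C b * F C \<tau> z" for C \<tau> z b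
      using eig by (simp add: w_def \<eta>_def integral_vec_scale)
    have cw: "integral_vec (of_int c *\<^sub>R w b)" for b
    proof -
      have "of_int c *\<^sub>R w b = of_int (int N * m) *\<^sub>R (of_int \<delta> *\<^sub>R (W *v int_vec b))"
        by (simp add: w_def c_def e matrix_vector_mult_scaleR ac_simps)
      then show ?thesis by (simp only: integral_vec_scale Ints_of_int \<delta>_W_integral integral_int_vec)
    qed
    have cq: "of_int c * (w b \<bullet> (T *v w b)) \<in> \<int>" for b
    proof -
      obtain l where l: "m * p = 2 * l" using m(2) by (elim dvdE)
      have "2 * (w b \<bullet> (T *v w b)) = of_int (p * p) * (int_vec b \<bullet> (W *v int_vec b))"
        unfolding w_def T_W by (simp add: matrix_vector_mult_scaleR inner_commute)
      then have "2 * (of_int c * (w b \<bullet> (T *v w b)))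
          = of_int (c * (p * p)) * (int_vec b \<bullet> (W *v int_vec b))"
        by simp
      \<comment> \<open>The 2 in \<open>m * p = 2 * l\<close> cancels the 2 coming from
        \<open>S = 2 T\<close>.\<close>
      also have "c * (p * p) = 2 * (int N * l * \<delta>)" using l by (simp add: c_def e algebra_simps)
      finally have "of_int c * (w b \<bullet> (T *v w b))
          = of_int (int N * l) * (int_vec b \<bullet> (of_int \<delta> *\<^sub>R (W *v int_vec b)))"
        by simp
      also have "\<dots> \<in> \<int>"
        by (intro Ints_mult Ints_of_int integral_vec_inner integral_int_vec \<delta>_W_integral)
      finally show ?thesis .
    qed
    \<comment> \<open>A nonzero component of this kind would have strictly fewer bad primes than the
      minimal \<open>C\<^sub>0\<close>.\<close>
    have zero: "F C \<tau> z = 0"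
      if C: "C \<in> cosets T" "\<eta> C = \<eta> C\<^sub>0" "C \<noteq> C\<^sub>0" and \<tau>: "\<tau> \<in> upper_half_plane" for C \<tau> z
    proof (rule ccontr)
      assume "F C \<tau> z \<noteq> 0"
      then have "nonzero C" using C(1) \<tau> by (auto simp: nonzero_def)
      let ?\<mu> = "rep C\<^sub>0" and ?\<nu> = "rep C"
      have "integral_vec (of_int p *\<^sub>R (W *v (int_vec ?\<nu> - int_vec ?\<mu>)))"
      proof (rule integral_vec_dual)
        fix b
        let ?x = "(W *v int_vec ?\<nu>) \<bullet> (of_int p *\<^sub>R int_vec b)"
          and ?y = "(W *v int_vec ?\<mu>) \<bullet> (of_int p *\<^sub>R int_vec b)"
        have "e2pi (of_real ?x) = e2pi (of_real ?y)" using C(2) by (metis \<eta>_def)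
        moreover have "e2pi (of_real ?x) = e2pi (of_real ?y) * e2pi (of_real (?x - ?y))"
          by (simp only: e2pi_add[symmetric] of_real_add[symmetric]) simp
        ultimately have "e2pi (of_real (?x - ?y)) = 1" by simp
        then have "?x - ?y \<in> \<int>" by (simp only: e2pi_eq_1_iff)
        then show "(of_int p *\<^sub>R (W *v (int_vec ?\<nu> - int_vec ?\<mu>))) \<bullet> int_vec b \<in> \<int>"
          by (simp add: matrix_vector_mult_diff_distrib inner_diff_left right_diff_distrib)
      qed
      moreover have "(?\<mu>, ?\<nu>) \<notin> coset_rel T"
        using C(1,3) C\<^sub>0_coset rep_in quotient_eq_iff[OF equiv_coset_rel] by (metis cosets_def)
      ultimately have "bad_primes ?\<nu> \<subset> bad_primes ?\<mu>" by (rule bad_primes_psubset[OF p])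
      then have "card (bad_primes ?\<nu>) < card (bad_primes ?\<mu>)"
        by (rule psubset_card_mono[OF finite_bad_primes])
      then show False using min[OF \<open>nonzero C\<close>] by simp
    qed
    have F_inv: "slash k T (lower c) (F C\<^sub>0) \<tau> z = F C\<^sub>0 \<tau> z" if \<tau>: "\<tau> \<in> upper_half_plane" for \<tau> z
    proof -
      \<comment> \<open>Each \<open>G C\<close> has character \<open>\<eta> C\<close>, since
        slashing preserves it, and the sum of all \<open>G C\<close> is 0. So the part with the
        character of \<open>C\<^sub>0\<close> vanishes, and by \<open>zero\<close> this part is
        \<open>G C\<^sub>0\<close> alone.\<close>
      define G where "G = (\<lambda>C z. slash k T (lower c) (F C) \<tau> z - F C \<tau> z)"
      have "G C (z + cvec (w b)) = \<eta> C b * G C z" for C b z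
        using slash_lower_eigen[OF T_sym per eig_p cw cq \<tau>] eig_p
        by (simp add: G_def right_diff_distrib)
      moreover have "(\<Sum>C\<in>cosets T. G C z) = 0" for z
      proof -
        have "(\<Sum>C\<in>cosets T. slash k T (lower c) (F C) \<tau> z) = slash k T (lower c) \<phi> \<tau> z"
          unfolding slash_lower \<phi>[OF lower_moebius(2)[OF \<tau>]] by (simp add: sum_distrib_right)
        also have "\<dots> = (\<Sum>C\<in>cosets T. F C \<tau> z)"
          using inv[OF _ \<tau>, of c] \<phi>[OF \<tau>] by (simp add: c_def)
        finally show ?thesis by (simp add: G_def sum_subtractf)
      qed
      ultimately have "(\<Sum>C\<in>{C \<in> cosets T. \<eta> C = \<eta> C\<^sub>0}. G C z) = 0"
        using isotypic_sum_eq_0[OF fin, of G "\<lambda>b. cvec (w b)" \<eta>] by blast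
      moreover have "(\<Sum>C\<in>{C \<in> cosets T. \<eta> C = \<eta> C\<^sub>0}. G C z) = (\<Sum>C\<in>{C\<^sub>0}. G C z)"
      proof (rule sum.mono_neutral_right)
        show "\<forall>C\<in>{C \<in> cosets T. \<eta> C = \<eta> C\<^sub>0} - {C\<^sub>0}. G C z = 0"
          using zero \<tau> lower_moebius(2)[OF \<tau>] by (simp add: G_def slash_lower)
      qed (use fin C\<^sub>0_coset in auto)
      ultimately show ?thesis by (simp add: G_def)
    qed
    have "F C\<^sub>0 \<tau> z = 0" if "\<tau> \<in> upper_half_plane" for \<tau> z
      using that eig F_inv by (rule single_component_not_invariant[OF p e c, rotated 2])
    then show False using C\<^sub>0 by (auto simp: nonzero_def)
  qed
  moreover have "\<exists>\<tau>\<in>upper_half_plane. h (coset T (rep C\<^sub>0)) \<tau> \<noteq> 0"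
    using C\<^sub>0 coset_rep[OF C\<^sub>0_coset] by (auto simp: nonzero_def F_def)
  ultimately show ?thesis by blast
qed

end

theorem theorem3p3:
  fixes T :: "real^'n^'n" and k :: int and N :: nat and \<psi> :: "int \<Rightarrow> complex"
    and \<phi> :: "complex \<Rightarrow> complex^'n \<Rightarrow> complex"
    and h :: "(int^'n) set \<Rightarrow> complex \<Rightarrow> complex"
  assumes "N > 0" and "odd N"
    and "dirichlet_character N \<psi>"
    and "T \<in> half_integral_pos" and "fundamental T"
    and "coprime (disc T) (int N)"
    and "\<phi> \<in> jacobi_cusp_forms k T N \<psi>"
    and "\<exists>\<tau>\<in>upper_half_plane. \<exists>z. \<phi> \<tau> z \<noteq> 0"
    and "theta_decomposition T \<phi> h"
  defines "q \<equiv> \<lambda>\<mu>::int^'n. qform (matrix_inv T) ((1/2) *\<^sub>R int_vec \<mu> :: real^'n)"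
  shows "\<exists>\<mu>. (\<exists>\<tau>\<in>upper_half_plane. h (coset T \<mu>) \<tau> \<noteq> 0) \<and>
             q \<mu> \<in> \<rat> \<and>
             denominator (q \<mu>) = int (lvl T) \<and>
             (\<forall>\<nu>. denominator (q \<nu>) \<le> denominator (q \<mu>))"
proof -
  interpret fundamental_index T using assms(4,5) by unfold_locales
  have "\<psi> 1 * \<psi> 1 = \<psi> 1 * 1" "\<psi> 1 \<noteq> 0"
    using assms(3) unfolding dirichlet_character_def by (metis mult.right_neutral, metis coprime_1_left)
  then have \<psi>1: "\<psi> 1 = 1" by (metis mult_left_cancel)
  \<comment> \<open>The lower right entry of \<open>lower c\<close> is 1, so the nebentypus factor
    is \<open>\<psi> 1 = 1\<close>.\<close>
  have "slash k T (lower c) \<phi> \<tau> z = \<phi> \<tau> z"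
    if "int N dvd c" "\<tau> \<in> upper_half_plane" for c \<tau> z
    using assms(7) lower_in_Gamma0[OF that(1)] that(2) \<psi>1
    by (auto simp: jacobi_cusp_forms_def jacobi_form_def)
  then obtain \<mu> where h: "\<exists>\<tau>\<in>upper_half_plane. h (coset T \<mu>) \<tau> \<noteq> 0" and bad: "bad_primes \<mu> = {}"
    using exists_primitive_component[OF coprime_\<delta>[OF assms(6,2)] assms(9) _ assms(8)] by blast
  have q: "q \<nu> = int_vec \<nu> \<bullet> (W *v int_vec \<nu>) / 2" for \<nu> by (simp add: q_def qform_half)
  have den: "denominator (q \<mu>) = L"
    unfolding q using bad by (intro denominator_eq_L) (auto simp: bad_primes_def)
  then have "int (lvl T) = L" unfolding q by (rule lvl_eq_L[rotated]) simp
  with h den show ?thesis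
    using q_Rats denominator_le_L by (intro exI[of _ \<mu>]) (simp add: q)
qed

end
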